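(* Let $m_x,m_y,m_z$ be the masses and $l_1,l_2$ the rod lengths of a free double linkage, $M:=m_x+m_y+m_z$, and $$r_1:=\frac{l_1(m_z+m_y)+l_2m_z}{M},\quad r_0:=\frac{l_1(m_z+m_y)-l_2m_z}{M},\quad a:=Mm_y(r_1-r_0)^2,\quad b:=4m_xm_z .$$ Provided $r_0\neq0$, the curves given in pedal coordinates by $$a^2\bigl(r^2+r_0r_1\bigr)^2\Bigl(\frac1{p^2}-\frac1{r^2}\Bigr)=\frac{(r^2-r_0^2)(r_1^2-r^2)(br^2+a)^2}{r^2}$$ are ellipses in a generalized rotational frame of reference (GRFR), with $r_1,r_0$ being the semi-axes of the original ellipse and with the ellipse of rotation having semi-axes $$A=\sqrt{\left|\frac{2r_1}{r_0}\,\frac{a-br_0r_1}{br_0^2+a}\right|},\qquad B=\sqrt{\left|\frac{2r_0}{r_1}\,\frac{a-br_0r_1}{br_1^2+a}\right|}.$$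
   Context: Free double linkage: three point masses $m_x,m_y,m_z$, where the middle one (mass $m_y$) is joined to the one of mass $m_x$ by a massless rigid rod of length $l_1$ and to the one of mass $m_z$ by a massless rigid rod of length $l_2$, with no outside forces. Pedal coordinates of a plane curve $\mathbf x(t)\in\mathbb R^2$ with respect to the origin: $r=|\mathbf x|$ and $p=\mathbf x^\perp\cdot\dot{\mathbf x}/|\dot{\mathbf x}|$, where $(x,y)^\perp=(-y,x)$. A pedal equation determines a curve without regard to rotation about the origin and to parametrization. Ellipse in GRFR: let the original ellipse be centered at the origin with semi-axes $\mathsf a$ (along the $x$-axis) and $\mathsf b$ (along the $y$-axis), and let the ellipse of rotation be a second ellipse, centered at the origin and coaxial with the first, with semi-axes $A$ (along the $x$-axis) and $B$ (along the $y$-axis). The point $(A\cos t,B\sin t)$ of the ellipse of rotation has a polar angle $\varphi$ with $\tan\varphi=\frac BA\tan t$, and the area swept by its radial vector up to that point is $S=\frac12ABt$. Take the point of the original ellipse with the same polar angle $\varphi$; its distance from the origin is $r=\mathsf a\mathsf b/\sqrt{\mathsf b^2\cos^2\varphi+\mathsf a^2\sin^2\varphi}$. Rotate this point about the origin by the angle $\pm S$, the sign (the same for all points) indicating an anticlockwise ($+$) or clockwise ($-$) rotation. The resulting curve, with polar coordinates $(r,\varphi\pm S)$, is the ellipse in GRFR. In the claim, $\mathsf a=r_1$ and $\mathsf b=r_0$, and the sign is the appropriate one of the two.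
   Formalization: The denominators br_0^2+a and br_1^2+a of A and B are interchanged (the printed claim fails); curves are regular C^2 with r not constant (circles r=r_1, r=|r_0| excluded); at p=0 the equation means r^2+r_0r_1=0; the semi-axis is |r_0|; if a=br_0r_1 nothing is rotated. *)

theory Defs
  imports "HOL-Analysis.Analysis"
begin

text \<open>The plane is identified with the complex numbers: \<open>(x, y)\<^sup>\<bottom> = (-y, x)\<close> is multiplication
  by \<open>\<i>\<close>, and the rotation about the origin by the angle \<open>\<alpha>\<close> is multiplication by \<open>cis \<alpha>\<close>.\<close>

definition velocity :: "(real \<Rightarrow> complex) \<Rightarrow> real \<Rightarrow> complex" where
  "velocity \<gamma> t = vector_derivative \<gamma> (at t)"

definition pedal_r :: "(real \<Rightarrow> complex) \<Rightarrow> real \<Rightarrow> real" where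
  "pedal_r \<gamma> t = norm (\<gamma> t)"

definition pedal_p :: "(real \<Rightarrow> complex) \<Rightarrow> real \<Rightarrow> real" where
  "pedal_p \<gamma> t = ((\<i> * \<gamma> t) \<bullet> velocity \<gamma> t) / norm (velocity \<gamma> t)"

definition regular_C2_curve :: "(real \<Rightarrow> complex) \<Rightarrow> real set \<Rightarrow> bool" where
  "regular_C2_curve \<gamma> I \<longleftrightarrow> open I \<and> is_interval I \<and>
     \<gamma> C1_differentiable_on I \<and> velocity \<gamma> C1_differentiable_on I \<and>
     (\<forall>t\<in>I. velocity \<gamma> t \<noteq> 0)"

definition satisfies_pedal_eq ::
  "(real \<Rightarrow> real \<Rightarrow> bool) \<Rightarrow> (real \<Rightarrow> complex) \<Rightarrow> real set \<Rightarrow> bool" where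
  "satisfies_pedal_eq E \<gamma> I \<longleftrightarrow>
     regular_C2_curve \<gamma> I \<and> (\<forall>t\<in>I. E (pedal_r \<gamma> t) (pedal_p \<gamma> t))"

text \<open>A point with \<open>p = 0\<close> (the tangent passes through the origin) is compatible with the equation
  exactly if the coefficient of the infinite term \<open>1 / p\<^sup>2\<close> vanishes there; multiplying the equation
  by \<open>p\<^sup>2\<close> gives the same condition. Such points do occur if \<open>r0 < 0\<close>. The explicit case is needed
  because division by zero yields zero.\<close>

definition linkage_pedal_eq :: "real \<Rightarrow> real \<Rightarrow> real \<Rightarrow> real \<Rightarrow> real \<Rightarrow> real \<Rightarrow> bool" where
  "linkage_pedal_eq r0 r1 a b r p \<longleftrightarrow> r \<noteq> 0 \<and>
     (p \<noteq> 0 \<longrightarrow> a^2 * (r^2 + r0 * r1)^2 * (1 / p^2 - 1 / r^2)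
                 = (r^2 - r0^2) * (r1^2 - r^2) * (b * r^2 + a)^2 / r^2) \<and>
     (p = 0 \<longrightarrow> a^2 * (r^2 + r0 * r1)^2 = 0)"

text \<open>Polar angle of the point \<open>(A cos t, B sin t)\<close>, as the branch that is continuous in \<open>t \<in> \<real>\<close>:
  for \<open>A, B > 0\<close> this angle and \<open>t\<close> lie in the same quadrant, so that their difference is the
  principal argument of a number with positive real part. For \<open>A = B = 0\<close> it is \<open>t\<close> itself
  (\<open>Arg 0 = 0\<close>).\<close>

definition rot_ellipse_angle :: "real \<Rightarrow> real \<Rightarrow> real \<Rightarrow> real" where
  "rot_ellipse_angle A B t = t + Arg (Complex (A * cos t) (B * sin t) * cis (- t))"

lemma rot_ellipse_angle_polar:
  "Complex (A * cos t) (B * sin t)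
     = of_real (norm (Complex (A * cos t) (B * sin t))) * cis (rot_ellipse_angle A B t)"
proof -
  let ?z = "Complex (A * cos t) (B * sin t)"
  have "?z * cis (- t) = of_real (norm (?z * cis (- t))) * cis (Arg (?z * cis (- t)))"
    by (metis rcis_cmod_Arg rcis_def)
  then have "?z * cis (- t) * cis t
      = of_real (norm ?z) * cis (Arg (?z * cis (- t))) * cis t"
    by (simp add: norm_mult)
  then show ?thesis
    by (simp add: rot_ellipse_angle_def mult.assoc cis_mult add.commute)
qed

lemma tan_rot_ellipse_angle:
  assumes "A > 0" "cos t \<noteq> 0"
  shows "tan (rot_ellipse_angle A B t) = B / A * tan t"
proof -
  define n where "n = norm (Complex (A * cos t) (B * sin t))"
  have "A * cos t = n * cos (rot_ellipse_angle A B t)"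
       "B * sin t = n * sin (rot_ellipse_angle A B t)"
    using arg_cong[OF rot_ellipse_angle_polar[of A t B], of Re]
          arg_cong[OF rot_ellipse_angle_polar[of A t B], of Im]
    by (simp_all add: n_def)
  moreover from this(1) have "n \<noteq> 0" using assms by auto
  ultimately have "(B * sin t) / (A * cos t) = tan (rot_ellipse_angle A B t)"
    by (simp add: tan_def)
  then show ?thesis by (simp add: tan_def)
qed

definition ellipse_polar_radius :: "real \<Rightarrow> real \<Rightarrow> real \<Rightarrow> real" where
  "ellipse_polar_radius sa sb \<phi> = sa * sb / sqrt (sb^2 * (cos \<phi>)^2 + sa^2 * (sin \<phi>)^2)"

definition swept_area :: "real \<Rightarrow> real \<Rightarrow> real \<Rightarrow> real" where
  "swept_area A B t = A * B * t / 2"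

text \<open>Ellipse in a generalized rotational frame of reference: original semi-axes \<open>sa, sb\<close>, ellipse of
  rotation with semi-axes \<open>A, B\<close>, and \<open>\<sigma> = 1\<close> (anticlockwise) or \<open>\<sigma> = -1\<close> (clockwise). If
  \<open>A = B = 0\<close> nothing is rotated and the curve is the original ellipse.\<close>

definition grfr_ellipse :: "real \<Rightarrow> real \<Rightarrow> real \<Rightarrow> real \<Rightarrow> real \<Rightarrow> real \<Rightarrow> complex" where
  "grfr_ellipse \<sigma> sa sb A B t =
     (let \<phi> = rot_ellipse_angle A B t
      in of_real (ellipse_polar_radius sa sb \<phi>) * cis (\<phi> + \<sigma> * swept_area A B t))"

text \<open>\<open>\<gamma>\<close> runs along \<open>\<delta>\<close>, up to a rotation about the origin and a regular change of parameter.\<close>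

definition is_arc_of :: "(real \<Rightarrow> complex) \<Rightarrow> real set \<Rightarrow> (real \<Rightarrow> complex) \<Rightarrow> bool" where
  "is_arc_of \<gamma> I \<delta> \<longleftrightarrow> (\<exists>\<alpha> \<tau>. \<tau> C1_differentiable_on I \<and> (\<forall>t\<in>I. deriv \<tau> t \<noteq> 0) \<and>
     (\<forall>t\<in>I. \<gamma> t = cis \<alpha> * \<delta> (\<tau> t)))"

text \<open>Choice of the denominators in the semi-axes of the ellipse of rotation. With respect to the polar
  angle \<open>\<phi>\<close>, the angle \<open>\<theta> = \<phi> + \<sigma> S\<close> on the ellipse in GRFR has derivative \<open>1 + \<sigma> \<rho>\<^sup>2 / 2\<close>, where
  \<open>1 / \<rho>\<^sup>2 = cos\<^sup>2 \<phi> / A\<^sup>2 + sin\<^sup>2 \<phi> / B\<^sup>2\<close>, while the pedal equation requires this derivative to be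
  \<open>a (r\<^sup>2 + r0 r1) / (r0 r1 (b r\<^sup>2 + a))\<close> up to sign (by continuity also at the apsides). For \<open>\<phi> = 0\<close>,
  where \<open>r = r1\<close> and \<open>\<rho> = A\<close>, this leads to the denominator \<open>b r1\<^sup>2 + a\<close> in \<open>A\<close>, and likewise to
  \<open>b r0\<^sup>2 + a\<close> in \<open>B\<close>. The published formulas have these two denominators interchanged, and then the
  claim fails, e.g. for three unit masses, \<open>l1 = 2\<close> and \<open>l2 = 1\<close>: the derivative at \<open>\<phi> = 0\<close> has to be
  \<open>2/7\<close> or \<open>-2/7\<close>, but \<open>1 + \<sigma> A\<^sup>2 / 2\<close> would be \<open>8/3\<close> or \<open>-2/3\<close>.\<close>

end

theory Submission
  imports Defs
begin

text \<open>Put \<open>u = 1 / r\<^sup>2\<close> and let \<open>w\<close> be the angular velocity of the curve. The pedal equation reads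
  \<open>(D u)\<^sup>2 u'\<^sup>2 = w\<^sup>2 Q u\<close> with \<open>Q u = 4 (1 / r0\<^sup>2 - u) (u - 1 / r1\<^sup>2)\<close> and
  \<open>D u = a (1 + r0 r1 u) / (r0 r1 (b + a u))\<close>. If \<open>u = U \<phi>\<close> belongs to the point with polar angle \<open>\<phi>\<close>
  on the original ellipse, then \<open>Q u = (K sin 2\<phi>)\<^sup>2\<close> and \<open>u' = K sin 2\<phi> \<phi>'\<close> with
  \<open>K = 1 / r0\<^sup>2 - 1 / r1\<^sup>2\<close>, so the equation becomes \<open>w = \<plusminus> D u \<phi>'\<close>. The ellipse in GRFR
  satisfies it with the plus sign, because \<open>D (U \<phi>) - 1\<close> is, up to the sign \<open>\<sigma>\<close>, the rate at which the ellipse of rotation sweeps area.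
  The minus sign amounts to reversing \<open>\<phi>\<close>. A solution of class \<open>C\<^sup>2\<close> can neither switch the sign
  where \<open>D u = 0\<close> nor stay on a circle at an apsis, and so it runs along the ellipse in GRFR.\<close>

section \<open>Continuously differentiable functions on an interval\<close>

lemma C1_differentiable_on_chain:
  assumes "f C1_differentiable_on S"
    and "\<And>x. x \<in> S \<Longrightarrow> (g has_vector_derivative g' (f x)) (at (f x))"
    and "continuous_on (f ` S) g'"
  shows "(\<lambda>x. g (f x)) C1_differentiable_on S"
proof -
  obtain f' where f': "\<And>x. x \<in> S \<Longrightarrow> (f has_vector_derivative f' x) (at x)" "continuous_on S f'"
    using assms(1) by (auto simp: C1_differentiable_on_def)
  have "continuous_on S f"
    using f'(1) by (meson continuous_at_imp_continuous_on has_vector_derivative_continuous)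
  then have "continuous_on S (\<lambda>x. f' x *\<^sub>R g' (f x))"
    by (intro continuous_on_scaleR f'(2) continuous_on_compose2[OF assms(3)]) auto
  moreover have "((\<lambda>x. g (f x)) has_vector_derivative f' x *\<^sub>R g' (f x)) (at x)" if "x \<in> S" for x
    using vector_diff_chain_at[OF f'(1)[OF that] assms(2)[OF that]] by (simp add: o_def)
  ultimately show ?thesis
    unfolding C1_differentiable_on_def by (intro exI[of _ "\<lambda>x. f' x *\<^sub>R g' (f x)"]) simp
qed

lemma C1_differentiable_on_bounded_linear:
  assumes "bounded_linear h" "f C1_differentiable_on S"
  shows "(\<lambda>x. h (f x)) C1_differentiable_on S"
proof -
  obtain f' where f': "\<And>x. x \<in> S \<Longrightarrow> (f has_vector_derivative f' x) (at x)" "continuous_on S f'"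
    using assms(2) by (auto simp: C1_differentiable_on_def)
  have "((\<lambda>x. h (f x)) has_vector_derivative h (f' x)) (at x)" if "x \<in> S" for x
    using bounded_linear.has_vector_derivative[OF assms(1) f'(1)[OF that]] .
  moreover have "continuous_on S (\<lambda>x. h (f' x))"
    using bounded_linear.continuous_on[OF assms(1) f'(2)] .
  ultimately show ?thesis
    unfolding C1_differentiable_on_def by (intro exI[of _ "\<lambda>x. h (f' x)"]) simp
qed

lemma C1_differentiable_on_cong:
  assumes "open S" "\<And>x. x \<in> S \<Longrightarrow> f x = g x" "f C1_differentiable_on S"
  shows "g C1_differentiable_on S"
proof -
  obtain f' where f': "\<And>x. x \<in> S \<Longrightarrow> (f has_vector_derivative f' x) (at x)" "continuous_on S f'"
    using assms(3) by (auto simp: C1_differentiable_on_def)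
  have "(g has_vector_derivative f' x) (at x)" if "x \<in> S" for x
    using has_vector_derivative_transform_within_open[OF f'(1)[OF that] assms(1) that assms(2)] .
  then show ?thesis
    using f'(2) unfolding C1_differentiable_on_def by blast
qed

lemma C1_differentiable_on_sin:
  fixes f :: "real \<Rightarrow> real"
  assumes "f C1_differentiable_on S"
  shows "(\<lambda>x. sin (f x)) C1_differentiable_on S"
  by (rule C1_differentiable_on_chain[OF assms, where g' = cos])
     (auto simp flip: has_real_derivative_iff_has_vector_derivative
       intro!: derivative_eq_intros continuous_intros)

lemma C1_differentiable_on_cos:
  fixes f :: "real \<Rightarrow> real"
  assumes "f C1_differentiable_on S"
  shows "(\<lambda>x. cos (f x)) C1_differentiable_on S"
  by (rule C1_differentiable_on_chain[OF assms, where g' = "\<lambda>x. - sin x"])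
     (auto simp flip: has_real_derivative_iff_has_vector_derivative
       intro!: derivative_eq_intros continuous_intros)

lemma C1_differentiable_on_power2:
  fixes f :: "real \<Rightarrow> real"
  assumes "f C1_differentiable_on S"
  shows "(\<lambda>x. (f x)\<^sup>2) C1_differentiable_on S"
  unfolding power2_eq_square using assms by simp

lemma C1_differentiable_on_sqrt:
  assumes "f C1_differentiable_on S" "\<And>x. x \<in> S \<Longrightarrow> f x > 0"
  shows "(\<lambda>x. sqrt (f x)) C1_differentiable_on S"
proof (rule C1_differentiable_on_chain[OF assms(1)])
  show "(sqrt has_vector_derivative inverse (sqrt (f x)) / 2) (at (f x))" if "x \<in> S" for x
    using DERIV_real_sqrt[OF assms(2)[OF that]]
    by (simp add: has_real_derivative_iff_has_vector_derivative)
  show "continuous_on (f ` S) (\<lambda>y. inverse (sqrt y) / 2)"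
    by (intro continuous_intros) (use assms(2) in force, simp)
qed

lemma C1_differentiable_on_divide:
  fixes f g :: "real \<Rightarrow> real"
  assumes "f C1_differentiable_on S" "g C1_differentiable_on S" "\<And>x. x \<in> S \<Longrightarrow> g x \<noteq> 0"
  shows "(\<lambda>x. f x / g x) C1_differentiable_on S"
proof -
  have "(\<lambda>x. inverse (g x)) C1_differentiable_on S"
    using assms(3)
    by (intro C1_differentiable_on_chain[OF assms(2), where g' = "\<lambda>x. - (1 / x\<^sup>2)"])
       (auto simp flip: has_real_derivative_iff_has_vector_derivative simp: power2_eq_square field_simps
         intro!: derivative_eq_intros continuous_intros)
  then show ?thesis
    using assms(1) by (simp add: divide_inverse)
qed

lemmas C1_intros =
  C1_differentiable_on_ident C1_differentiable_on_const C1_differentiable_on_add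
  C1_differentiable_on_minus C1_differentiable_on_diff C1_differentiable_on_mult
  C1_differentiable_on_sin C1_differentiable_on_cos
  C1_differentiable_on_power2 C1_differentiable_on_sqrt C1_differentiable_on_divide
  C1_differentiable_on_bounded_linear[OF bounded_linear_Re]
  C1_differentiable_on_bounded_linear[OF bounded_linear_Im]
  C1_differentiable_on_bounded_linear[OF bounded_linear_cnj]
  C1_differentiable_on_bounded_linear[OF bounded_linear_of_real]

lemma C1_differentiable_on_imp_deriv:
  fixes f :: "real \<Rightarrow> real"
  assumes "f C1_differentiable_on S"
  shows "\<And>x. x \<in> S \<Longrightarrow> (f has_real_derivative deriv f x) (at x)"
    and "continuous_on S (deriv f)"
proof -
  obtain f' where f': "\<And>x. x \<in> S \<Longrightarrow> (f has_real_derivative f' x) (at x)" "continuous_on S f'"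
    using assms by (auto simp: C1_differentiable_on_def has_real_derivative_iff_has_vector_derivative)
  show "(f has_real_derivative deriv f x) (at x)" if "x \<in> S" for x
    using f'(1)[OF that] DERIV_imp_deriv[OF f'(1)[OF that]] by simp
  show "continuous_on S (deriv f)"
    using f' by (metis DERIV_imp_deriv continuous_on_cong)
qed

lemma C1_differentiable_on_continuous:
  "f C1_differentiable_on S \<Longrightarrow> continuous_on S f"
  by (meson C1_diff_imp_diff differentiable_imp_continuous_on)

section \<open>Antiderivatives and constancy on an interval\<close>

lemma continuous_antiderivative_on_interval:
  fixes f :: "real \<Rightarrow> real"
  assumes I: "open I" "is_interval I" and f: "continuous_on I f" and c: "c \<in> I"
  obtains F where "F c = k" "\<And>x. x \<in> I \<Longrightarrow> (F has_real_derivative f x) (at x)"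
proof -
  define F where "F u = k + (LBINT y=c..u. f y)" for u
  have "(F has_real_derivative f x) (at x)" if "x \<in> I" for x
  proof -
    obtain e where e: "e > 0" "cball x e \<subseteq> I"
      using I(1) \<open>x \<in> I\<close> open_contains_cball by blast
    \<comment> \<open>The compact interval from \<open>l\<close> to \<open>h\<close> contains the
      base point \<open>c\<close> and has \<open>x\<close> in its interior, so the fundamental
      theorem applies on it and yields a two-sided derivative at \<open>x\<close>.\<close>
    define l where "l = min c (x - e)"
    define h where "h = max c (x + e)"
    have "l \<in> I" "h \<in> I"
      using c e by (auto simp: l_def h_def min_def max_def cball_def dist_real_def)
    then have "{l..h} \<subseteq> I"
      using I(2) by (meson atLeastAtMost_iff is_interval_1 subsetI)
    then have "continuous_on {l..h} f"
      using f continuous_on_subset by blast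
    then have "((\<lambda>u. LBINT y=c..u. f y) has_vector_derivative f x) (at x within {l..h})"
      by (rule interval_integral_FTC2[rotated 2]) (use e in \<open>auto simp: l_def h_def\<close>)
    moreover have "at x within {l..h} = at x"
      by (rule at_within_Icc_at) (use e in \<open>auto simp: l_def h_def\<close>)
    ultimately have "((\<lambda>u. LBINT y=c..u. f y) has_real_derivative f x) (at x)"
      by (simp only: has_real_derivative_iff_has_vector_derivative)
    from DERIV_add[OF DERIV_const[of k] this] show ?thesis
      unfolding F_def by (simp only: add_0_left)
  qed
  then show ?thesis
    using that[of F] by (simp add: F_def)
qed

lemma eq_if_vector_derivative_zero:
  fixes f :: "real \<Rightarrow> 'a::real_normed_vector"
  assumes "is_interval I" "\<And>x. x \<in> I \<Longrightarrow> (f has_vector_derivative 0) (at x)" "x \<in> I" "y \<in> I"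
  shows "f x = f y"
  using has_vector_derivative_zero_constant[of I f] assms
  by (metis has_vector_derivative_at_within is_interval_convex)

section \<open>Zeros of differentiable functions and of products\<close>

lemma eventually_neq_zero_if_deriv_neq_zero:
  fixes f :: "real \<Rightarrow> real"
  assumes "(f has_real_derivative d) (at x)" "f x = 0" "d \<noteq> 0"
  shows "eventually (\<lambda>y. f y \<noteq> 0) (at x)"
proof -
  have "((\<lambda>y. (f y - f x) / (y - x)) \<longlongrightarrow> d) (at x)"
    using assms(1) by (simp add: has_field_derivative_iff)
  then have "eventually (\<lambda>y. (f y - f x) / (y - x) \<noteq> 0) (at x)"
    using assms(3) tendsto_imp_eventually_ne by blast
  then show ?thesis
    by eventually_elim (use assms(2) in auto)
qed

lemma deriv_eq_zero_if_eventually_zero: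
  fixes f :: "real \<Rightarrow> real"
  assumes "(f has_real_derivative d) (at x)" "eventually (\<lambda>y. f y = 0) (at x)" "f x = 0"
  shows "d = 0"
proof (rule ccontr)
  assume "d \<noteq> 0"
  with assms have "eventually (\<lambda>y. f y \<noteq> 0) (at x)"
    using eventually_neq_zero_if_deriv_neq_zero by blast
  with assms(2) have "eventually (\<lambda>y. False) (at x)"
    by eventually_elim auto
  then show False by simp
qed

text \<open>A product of two functions can vanish identically on an interval without either factor doing so;
  this is excluded by a condition on the common zeros of the factors.\<close>

lemma eventually_cofactor_zero:
  fixes f g :: "real \<Rightarrow> real"
  assumes "open I" "t \<in> I" "\<And>s. s \<in> I \<Longrightarrow> f s * g s = 0"
    and "(f has_real_derivative d) (at t)" "f t = 0" "d \<noteq> 0"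
  shows "eventually (\<lambda>s. g s = 0) (at t)"
proof -
  have "eventually (\<lambda>s. s \<in> I) (at t)"
    using assms(1,2) by (simp add: eventually_at_in_open')
  moreover have "eventually (\<lambda>s. f s \<noteq> 0) (at t)"
    using eventually_neq_zero_if_deriv_neq_zero assms by blast
  ultimately show ?thesis
    by eventually_elim (use assms(3) in auto)
qed

text \<open>The multiple zeros of \<open>f\<close> and the zeros of \<open>g\<close> form two
  disjoint, relatively closed sets. They cover \<open>I\<close>: near a simple zero of
  \<open>f\<close> the other factor vanishes, so by continuity \<open>g\<close> is zero there too.
  Connectedness leaves one of the two sets empty.\<close>

lemma factor_zero_if_mult_zero_C0:
  fixes f f' g :: "real \<Rightarrow> real"
  assumes I: "open I" "connected I"
    and fg: "\<And>t. t \<in> I \<Longrightarrow> f t * g t = 0"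
    and f': "\<And>t. t \<in> I \<Longrightarrow> (f has_real_derivative f' t) (at t)"
    and cont: "continuous_on I f'" "continuous_on I g"
    and disj: "\<And>t. t \<in> I \<Longrightarrow> f t = 0 \<Longrightarrow> f' t = 0 \<Longrightarrow> g t \<noteq> 0"
  shows "(\<forall>t\<in>I. f t = 0) \<or> (\<forall>t\<in>I. g t = 0)"
proof -
  define X where "X = {t \<in> I. f t = 0} \<inter> {t \<in> I. f' t = 0}"
  define Y where "Y = {t \<in> I. g t = 0}"
  have "continuous_on I f"
    using f' by (meson DERIV_continuous continuous_at_imp_continuous_on)
  then have "closedin (top_of_set I) X" "closedin (top_of_set I) Y"
    using cont unfolding X_def Y_def
    by (auto intro!: continuous_closedin_preimage_constant closedin_Int)
  moreover have cover: "t \<in> X \<or> t \<in> Y" if t: "t \<in> I" for t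
  proof (cases "f t = 0 \<and> f' t \<noteq> 0")
    case True
    then have "eventually (\<lambda>s. g s = 0) (at t)"
      using eventually_cofactor_zero[OF I(1) t fg f'[OF t]] by blast
    then have "(g \<longlongrightarrow> 0) (at t)"
      using tendsto_eventually by blast
    moreover have "isCont g t"
      using cont(2) I(1) t continuous_on_eq_continuous_at by blast
    ultimately have "g t = 0"
      by (metis LIM_unique isCont_def)
    then show ?thesis using t by (simp add: Y_def)
  next
    case False
    then show ?thesis
      using t fg[OF t] by (auto simp: X_def Y_def)
  qed
  then have "I \<subseteq> X \<union> Y"
    by auto
  moreover have "X \<inter> Y = {}"
    using disj by (auto simp: X_def Y_def)
  moreover have "X \<subseteq> I" "Y \<subseteq> I"
    by (auto simp: X_def Y_def)
  ultimately have "X = {} \<or> Y = {}"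
    using I(2) unfolding connected_closedin by blast
  then show ?thesis
    using cover
    by (auto simp: X_def Y_def)
qed

text \<open>The same covering argument, now with the multiple zeros of \<open>f\<close> and those of
  \<open>g\<close>. Where one factor is nonzero, the other vanishes nearby together with its
  derivative; at a simple zero of \<open>f\<close> the function \<open>g\<close> vanishes
  nearby.\<close>

lemma factor_zero_if_mult_zero_C1:
  fixes f f' g g' :: "real \<Rightarrow> real"
  assumes I: "open I" "connected I"
    and fg: "\<And>t. t \<in> I \<Longrightarrow> f t * g t = 0"
    and f': "\<And>t. t \<in> I \<Longrightarrow> (f has_real_derivative f' t) (at t)"
    and g': "\<And>t. t \<in> I \<Longrightarrow> (g has_real_derivative g' t) (at t)"
    and cont: "continuous_on I f'" "continuous_on I g'"
    and disj: "\<And>t. t \<in> I \<Longrightarrow> f t = 0 \<Longrightarrow> g t = 0 \<Longrightarrow> f' t \<noteq> 0 \<or> g' t \<noteq> 0"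
  shows "(\<forall>t\<in>I. f t = 0) \<or> (\<forall>t\<in>I. g t = 0)"
proof -
  define X where "X = {t \<in> I. f t = 0} \<inter> {t \<in> I. f' t = 0}"
  define Y where "Y = {t \<in> I. g t = 0} \<inter> {t \<in> I. g' t = 0}"
  have "continuous_on I f" "continuous_on I g"
    using f' g' by (meson DERIV_continuous continuous_at_imp_continuous_on)+
  then have "closedin (top_of_set I) X" "closedin (top_of_set I) Y"
    using cont unfolding X_def Y_def
    by (auto intro!: continuous_closedin_preimage_constant closedin_Int)
  moreover have cover: "t \<in> X \<or> t \<in> Y" if t: "t \<in> I" for t
  proof -
    consider "f t \<noteq> 0" | "g t \<noteq> 0" | "f t = 0" "g t = 0" by blast
    then show ?thesis
    proof cases
      case 1
      have "isCont f t" using DERIV_isCont f' t by blast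
      then have "eventually (\<lambda>s. f s \<noteq> 0) (at t)"
        using 1 by (simp add: isCont_def tendsto_imp_eventually_ne)
      moreover have "eventually (\<lambda>s. s \<in> I) (at t)"
        using I(1) t by (simp add: eventually_at_in_open')
      ultimately have "eventually (\<lambda>s. g s = 0) (at t)"
        by eventually_elim (use fg in auto)
      then show ?thesis
        using deriv_eq_zero_if_eventually_zero[OF g'[OF t]] 1 fg[OF t] t by (auto simp: Y_def)
    next
      case 2
      have "isCont g t" using DERIV_isCont g' t by blast
      then have "eventually (\<lambda>s. g s \<noteq> 0) (at t)"
        using 2 by (simp add: isCont_def tendsto_imp_eventually_ne)
      moreover have "eventually (\<lambda>s. s \<in> I) (at t)"
        using I(1) t by (simp add: eventually_at_in_open')
      ultimately have "eventually (\<lambda>s. f s = 0) (at t)"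
        by eventually_elim (use fg in auto)
      then show ?thesis
        using deriv_eq_zero_if_eventually_zero[OF f'[OF t]] 2 fg[OF t] t by (auto simp: X_def)
    next
      case 3
      then show ?thesis
        using eventually_cofactor_zero[OF I(1) t fg f'[OF t]] deriv_eq_zero_if_eventually_zero[OF g'[OF t]] t
        by (auto simp: X_def Y_def)
    qed
  qed
  then have "I \<subseteq> X \<union> Y"
    by auto
  moreover have "X \<inter> Y = {}"
    using disj by (auto simp: X_def Y_def)
  moreover have "X \<subseteq> I" "Y \<subseteq> I"
    by (auto simp: X_def Y_def)
  ultimately have "X = {} \<or> Y = {}"
    using I(2) unfolding connected_closedin by blast
  then show ?thesis
    using cover
    by (auto simp: X_def Y_def)
qed

section \<open>The ellipse of rotation\<close>

lemma weighted_cos_sin_pos: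
  fixes c d :: real
  assumes "c > 0" "d > 0"
  shows "c * (cos t)\<^sup>2 + d * (sin t)\<^sup>2 > 0"
  using assms sin_cos_squared_add[of t]
  by (smt (verit) mult_nonneg_nonneg mult_pos_pos zero_le_power2 zero_less_power2 zero_neq_one)

text \<open>For positive semi-axes the number whose argument is taken has positive real part, so
  that \<open>Arg\<close> is an arctangent and the angle can be differentiated on the whole line. In
  the degenerate case the quotient is \<open>0 / 0 = 0\<close>, which agrees with
  \<open>Arg 0 = 0\<close>.\<close>

lemma rot_ellipse_angle_arctan:
  assumes "A > 0 \<and> B > 0 \<or> A = 0 \<and> B = 0"
  shows "rot_ellipse_angle A B t
    = t + arctan ((B - A) * sin t * cos t / (A * (cos t)\<^sup>2 + B * (sin t)\<^sup>2))"
proof (cases "A = 0")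
  case True
  moreover have "Complex 0 0 = 0"
    by (simp add: complex_eq_iff)
  ultimately show ?thesis
    using assms by (simp add: rot_ellipse_angle_def Arg_zero)
next
  case False
  define z where "z = Complex (A * cos t) (B * sin t) * cis (- t)"
  have Re: "Re z = A * (cos t)\<^sup>2 + B * (sin t)\<^sup>2" and Im: "Im z = (B - A) * sin t * cos t"
    by (simp_all add: z_def power2_eq_square algebra_simps)
  have "Re z > 0"
    using assms False weighted_cos_sin_pos unfolding Re by blast
  then show ?thesis
    by (simp add: rot_ellipse_angle_def arg_conv_arctan flip: z_def Re Im)
qed

lemma rot_ellipse_angle_0: "rot_ellipse_angle A B 0 = 0" if "A > 0 \<and> B > 0 \<or> A = 0 \<and> B = 0"
  using that by (simp add: rot_ellipse_angle_arctan)

text \<open>This is the derivative of the polar angle with respect to \<open>t\<close>. The value 1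
  belongs to the degenerate ellipse \<open>A = B = 0\<close>, whose angle is \<open>t\<close>
  itself.\<close>

definition rot_ellipse_rate :: "real \<Rightarrow> real \<Rightarrow> real \<Rightarrow> real" where
  "rot_ellipse_rate A B t = (if A = 0 then 1 else A * B / (A\<^sup>2 * (cos t)\<^sup>2 + B\<^sup>2 * (sin t)\<^sup>2))"

lemma rot_ellipse_rate_pos:
  assumes "A > 0 \<and> B > 0 \<or> A = 0 \<and> B = 0"
  shows "rot_ellipse_rate A B t > 0"
  using assms weighted_cos_sin_pos[of "A\<^sup>2" "B\<^sup>2" t] by (auto simp: rot_ellipse_rate_def)

lemma C1_differentiable_on_rot_ellipse_rate:
  assumes "A > 0 \<and> B > 0 \<or> A = 0 \<and> B = 0"
  shows "rot_ellipse_rate A B C1_differentiable_on S"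
proof (cases "A = 0")
  case True
  then show ?thesis by (simp add: rot_ellipse_rate_def[abs_def])
next
  case False
  then have "A\<^sup>2 * (cos t)\<^sup>2 + B\<^sup>2 * (sin t)\<^sup>2 \<noteq> 0" for t
    using assms weighted_cos_sin_pos[of "A\<^sup>2" "B\<^sup>2" t] by force
  with False show ?thesis
    by (simp add: rot_ellipse_rate_def[abs_def] C1_intros)
qed

lemma has_real_derivative_rot_ellipse_angle:
  assumes AB: "A > 0 \<and> B > 0 \<or> A = 0 \<and> B = 0"
  shows "(rot_ellipse_angle A B has_real_derivative rot_ellipse_rate A B t) (at t)"
proof (cases "A = 0")
  case True
  then have "rot_ellipse_angle A B = (\<lambda>t. t)"
    using AB by (auto simp: rot_ellipse_angle_arctan)
  then show ?thesis
    using True by (auto simp: rot_ellipse_rate_def intro!: derivative_eq_intros)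
next
  case False
  define N where "N t = (B - A) * sin t * cos t" for t
  define M where "M t = A * (cos t)\<^sup>2 + B * (sin t)\<^sup>2" for t
  have M: "M t > 0" for t
    unfolding M_def using False AB by (intro weighted_cos_sin_pos) auto
  define N' where "N' = (B - A) * ((cos t)\<^sup>2 - (sin t)\<^sup>2)"
  define M' where "M' = 2 * (B - A) * sin t * cos t"
  have N': "(N has_real_derivative N') (at t)"
    unfolding N_def N'_def by (auto intro!: derivative_eq_intros simp: power2_eq_square algebra_simps)
  have M': "(M has_real_derivative M') (at t)"
    unfolding M_def M'_def by (auto intro!: derivative_eq_intros simp: power2_eq_square algebra_simps)
  have "((\<lambda>t. t + arctan (N t / M t)) has_real_derivative
      1 + (N' * M t - N t * M') / (M t * M t) / (1 + (N t / M t)\<^sup>2)) (at t)"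
    using M[of t] by (auto intro!: derivative_eq_intros N' M' simp: field_simps)
  moreover have "1 + (N' * M t - N t * M') / (M t * M t) / (1 + (N t / M t)\<^sup>2)
      = ((M t)\<^sup>2 + (N t)\<^sup>2 + (N' * M t - N t * M')) / ((M t)\<^sup>2 + (N t)\<^sup>2)"
  proof -
    have pos: "(M t)\<^sup>2 + (N t)\<^sup>2 > 0" using M[of t] by (simp add: add_pos_nonneg)
    have "1 + (N t / M t)\<^sup>2 = ((M t)\<^sup>2 + (N t)\<^sup>2) / (M t * M t)"
      using M[of t] by (simp add: power2_eq_square field_simps)
    then have "(N' * M t - N t * M') / (M t * M t) / (1 + (N t / M t)\<^sup>2)
        = (N' * M t - N t * M') / ((M t)\<^sup>2 + (N t)\<^sup>2)"
      using M[of t] by simp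
    moreover have "1 + x / s = (s + x) / s" if "s > 0" for x s :: real
      using that by (simp add: field_simps)
    ultimately show ?thesis
      using pos by presburger
  qed
  \<comment> \<open>\<open>M t\<close> and \<open>N t\<close> are the real and imaginary parts of
    the point of the ellipse turned by \<open>- t\<close>, which keeps its norm.\<close>
  moreover have "(M t)\<^sup>2 + (N t)\<^sup>2 = A\<^sup>2 * (cos t)\<^sup>2 + B\<^sup>2 * (sin t)\<^sup>2"
    using sin_cos_squared_add[of t] unfolding M_def N_def by algebra
  moreover have "(M t)\<^sup>2 + (N t)\<^sup>2 + (N' * M t - N t * M') = A * B"
    using sin_cos_squared_add[of t] unfolding M_def N_def M'_def N'_def by algebra
  moreover have "rot_ellipse_angle A B = (\<lambda>t. t + arctan (N t / M t))"
    using AB by (auto simp: rot_ellipse_angle_arctan N_def M_def)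
  ultimately show ?thesis
    using False by (simp add: rot_ellipse_rate_def)
qed

lemma C1_differentiable_on_rot_ellipse_angle:
  assumes "A > 0 \<and> B > 0 \<or> A = 0 \<and> B = 0"
  shows "rot_ellipse_angle A B C1_differentiable_on S"
  unfolding C1_differentiable_on_def
  using has_real_derivative_rot_ellipse_angle[OF assms]
    C1_differentiable_on_continuous[OF C1_differentiable_on_rot_ellipse_rate[OF assms]]
  by (auto simp: has_real_derivative_iff_has_vector_derivative)

lemma rot_ellipse_angle_coords:
  obtains n where "A * cos t = n * cos (rot_ellipse_angle A B t)"
    "B * sin t = n * sin (rot_ellipse_angle A B t)" "n\<^sup>2 = A\<^sup>2 * (cos t)\<^sup>2 + B\<^sup>2 * (sin t)\<^sup>2"
proof
  define n where "n = norm (Complex (A * cos t) (B * sin t))"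
  show "A * cos t = n * cos (rot_ellipse_angle A B t)"
       "B * sin t = n * sin (rot_ellipse_angle A B t)"
    using arg_cong[OF rot_ellipse_angle_polar[of A t B], of Re]
          arg_cong[OF rot_ellipse_angle_polar[of A t B], of Im]
    by (simp_all add: n_def)
  show "n\<^sup>2 = A\<^sup>2 * (cos t)\<^sup>2 + B\<^sup>2 * (sin t)\<^sup>2"
    by (simp add: n_def cmod_power2 power_mult_distrib)
qed

text \<open>If \<open>n\<close> is the distance of the point of the ellipse of rotation from the
  origin, the two rates are \<open>n\<^sup>2 / (A * B)\<close> and
  \<open>A * B / n\<^sup>2\<close>.\<close>

lemma rot_ellipse_rate_inverse:
  assumes AB: "A > 0 \<and> B > 0 \<or> A = 0 \<and> B = 0"
  shows "rot_ellipse_rate B A (rot_ellipse_angle A B t) * rot_ellipse_rate A B t = 1"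
proof (cases "A = 0")
  case True
  then show ?thesis using AB by (simp add: rot_ellipse_rate_def)
next
  case False
  then have pos: "A > 0" "B > 0" using AB by auto
  define \<phi> where "\<phi> = rot_ellipse_angle A B t"
  obtain n where n: "A * cos t = n * cos \<phi>" "B * sin t = n * sin \<phi>"
    "n\<^sup>2 = A\<^sup>2 * (cos t)\<^sup>2 + B\<^sup>2 * (sin t)\<^sup>2"
    using rot_ellipse_angle_coords unfolding \<phi>_def by blast
  have n2: "n\<^sup>2 > 0"
    unfolding n(3) using pos by (intro weighted_cos_sin_pos) auto
  have "n\<^sup>2 * (B\<^sup>2 * (cos \<phi>)\<^sup>2 + A\<^sup>2 * (sin \<phi>)\<^sup>2) = B\<^sup>2 * (n * cos \<phi>)\<^sup>2 + A\<^sup>2 * (n * sin \<phi>)\<^sup>2"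
    by algebra
  also have "\<dots> = A\<^sup>2 * B\<^sup>2"
    unfolding n(1,2)[symmetric] using sin_cos_squared_add[of t] by algebra
  finally have "B\<^sup>2 * (cos \<phi>)\<^sup>2 + A\<^sup>2 * (sin \<phi>)\<^sup>2 = A\<^sup>2 * B\<^sup>2 / n\<^sup>2"
    using n2 by (simp add: field_simps)
  then have "rot_ellipse_rate B A \<phi> = B * A / (A\<^sup>2 * B\<^sup>2 / n\<^sup>2)"
    using pos by (simp add: rot_ellipse_rate_def)
  moreover have "rot_ellipse_rate A B t = A * B / n\<^sup>2"
    using pos by (simp add: rot_ellipse_rate_def n(3))
  ultimately show ?thesis
    using pos n2 unfolding \<phi>_def[symmetric] by (auto simp: power2_eq_square)
qed

text \<open>Interchanging the semi-axes inverts the relation between \<open>tan t\<close> and the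
  tangent of the polar angle. With the continuous branches this holds for the angles themselves: by
  the chain rule the difference from the identity is constant, and it is zero at 0. Curves can thus
  be parametrized by the polar angle in place of \<open>t\<close>.\<close>

lemma rot_ellipse_angle_inverse:
  assumes AB: "A > 0 \<and> B > 0 \<or> A = 0 \<and> B = 0"
  shows "rot_ellipse_angle B A (rot_ellipse_angle A B t) = t"
proof -
  have BA: "B > 0 \<and> A > 0 \<or> B = 0 \<and> A = 0" using AB by auto
  have "((\<lambda>t. rot_ellipse_angle B A (rot_ellipse_angle A B t) - t) has_real_derivative 0) (at t)" for t
    using DERIV_diff[OF DERIV_chain2[OF has_real_derivative_rot_ellipse_angle[OF BA]
          has_real_derivative_rot_ellipse_angle[OF AB]] DERIV_ident, of t]
    by (simp add: rot_ellipse_rate_inverse[OF AB])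
  then have "rot_ellipse_angle B A (rot_ellipse_angle A B t) - t
      = rot_ellipse_angle B A (rot_ellipse_angle A B 0) - 0"
    by (intro DERIV_isconst_all) auto
  then show ?thesis
    by (simp add: rot_ellipse_angle_0 AB BA)
qed

text \<open>The left-hand side is the derivative of the swept area with respect to the polar angle.
  The semi-axes satisfy \<open>A\<^sup>2 = 2 * \<bar>k\<bar> / p\<close> and
  \<open>B\<^sup>2 = 2 * \<bar>k\<bar> / q\<close>, where \<open>p\<close> and \<open>q\<close> are
  the values of the denominator on the right at the angles 0 and \<pi>/2.\<close>

lemma grfr_rate:
  fixes r0 r1 a b A B :: real
  assumes r0: "r0 \<noteq> 0" and r1: "r1 > 0" and a: "a > 0" and b: "b > 0"
    and A: "A = sqrt \<bar>2 * r1 / r0 * ((a - b * r0 * r1) / (b * r1\<^sup>2 + a))\<bar>"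
    and B: "B = sqrt \<bar>2 * r0 / r1 * ((a - b * r0 * r1) / (b * r0\<^sup>2 + a))\<bar>"
  defines "k \<equiv> (a - b * r0 * r1) / (r0 * r1)"
  shows "A > 0 \<and> B > 0 \<or> A = 0 \<and> B = 0"
    and "A * B / 2 * rot_ellipse_rate B A \<phi>
      = \<bar>k\<bar> / (b + a * ((cos \<phi>)\<^sup>2 / r1\<^sup>2 + (sin \<phi>)\<^sup>2 / r0\<^sup>2))"
proof -
  define p where "p = b + a / r1\<^sup>2"
  define q where "q = b + a / r0\<^sup>2"
  have pq: "p > 0" "q > 0"
    using r0 r1 a b by (simp_all add: p_def q_def add_pos_pos)
  have "2 * r1 / r0 * ((a - b * r0 * r1) / (b * r1\<^sup>2 + a)) = 2 * k / p"
    "2 * r0 / r1 * ((a - b * r0 * r1) / (b * r0\<^sup>2 + a)) = 2 * k / q"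
    using r0 r1 a b pq unfolding k_def p_def q_def
    by (simp_all add: divide_simps power2_eq_square add_pos_pos)
  then have A2: "A\<^sup>2 = 2 * \<bar>k\<bar> / p" and B2: "B\<^sup>2 = 2 * \<bar>k\<bar> / q"
    and AB: "A = sqrt (2 * \<bar>k\<bar> / p)" "B = sqrt (2 * \<bar>k\<bar> / q)"
    using pq by (simp_all add: A B abs_mult abs_divide)
  show "A > 0 \<and> B > 0 \<or> A = 0 \<and> B = 0"
    using pq unfolding AB by (cases "k = 0") auto
  have "b + a * ((cos \<phi>)\<^sup>2 / r1\<^sup>2 + (sin \<phi>)\<^sup>2 / r0\<^sup>2) = p * (cos \<phi>)\<^sup>2 + q * (sin \<phi>)\<^sup>2"
  proof -
    have "b + a * (c * y + s * x) = (b + a * y) * c + (b + a * x) * s" if "s + c = 1" for c s x y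
      using that by algebra
    from this[OF sin_cos_squared_add, of \<phi> "1 / r1\<^sup>2" "1 / r0\<^sup>2"] show ?thesis
      unfolding p_def q_def by simp
  qed
  moreover have "A * B / 2 * rot_ellipse_rate B A \<phi> = \<bar>k\<bar> / (p * (cos \<phi>)\<^sup>2 + q * (sin \<phi>)\<^sup>2)"
  proof (cases "k = 0")
    case True
    then show ?thesis using AB by simp
  next
    case False
    then have "B \<noteq> 0" using AB pq by simp
    have pos: "p * (cos \<phi>)\<^sup>2 + q * (sin \<phi>)\<^sup>2 > 0"
      using pq by (rule weighted_cos_sin_pos)
    have "A * B / 2 * rot_ellipse_rate B A \<phi> = A\<^sup>2 * B\<^sup>2 / 2 / (B\<^sup>2 * (cos \<phi>)\<^sup>2 + A\<^sup>2 * (sin \<phi>)\<^sup>2)"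
      using \<open>B \<noteq> 0\<close> by (simp add: rot_ellipse_rate_def power2_eq_square)
    also have "B\<^sup>2 * (cos \<phi>)\<^sup>2 + A\<^sup>2 * (sin \<phi>)\<^sup>2 = 2 * \<bar>k\<bar> * (p * (cos \<phi>)\<^sup>2 + q * (sin \<phi>)\<^sup>2) / (p * q)"
      unfolding A2 B2 using pq by (simp add: field_simps)
    also have "A\<^sup>2 * B\<^sup>2 / 2 / \<dots> = \<bar>k\<bar> / (p * (cos \<phi>)\<^sup>2 + q * (sin \<phi>)\<^sup>2)"
      unfolding A2 B2 using pq pos False by (simp add: divide_simps)
    finally show ?thesis .
  qed
  ultimately show "A * B / 2 * rot_ellipse_rate B A \<phi>
      = \<bar>k\<bar> / (b + a * ((cos \<phi>)\<^sup>2 / r1\<^sup>2 + (sin \<phi>)\<^sup>2 / r0\<^sup>2))"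
    by (simp only:)
qed

section \<open>The pedal equation\<close>

locale linkage_pedal =
  fixes r0 r1 a b :: real
  assumes r0_nz: "r0 \<noteq> 0" and r0_r1: "\<bar>r0\<bar> < r1" and a_pos: "a > 0" and b_pos: "b > 0"
begin

definition K :: real where "K = 1 / r0\<^sup>2 - 1 / r1\<^sup>2"

definition U :: "real \<Rightarrow> real" where "U \<phi> = (cos \<phi>)\<^sup>2 / r1\<^sup>2 + (sin \<phi>)\<^sup>2 / r0\<^sup>2"

definition D :: "real \<Rightarrow> real" where "D u = a * (1 + r0 * r1 * u) / (r0 * r1 * (b + a * u))"

definition Q :: "real \<Rightarrow> real" where "Q u = 4 * (1 / r0\<^sup>2 - u) * (u - 1 / r1\<^sup>2)"

lemma r1_pos: "r1 > 0"
  using r0_r1 by linarith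

lemma r0_sq_less: "r0\<^sup>2 < r1\<^sup>2"
  using power_strict_mono[OF r0_r1, of 2] by simp

lemma K_pos: "K > 0"
  using r0_sq_less r0_nz r1_pos by (simp add: K_def field_simps)

lemma U_pos: "U \<phi> > 0"
  using weighted_cos_sin_pos[of "1 / r1\<^sup>2" "1 / r0\<^sup>2" \<phi>] r0_nz r1_pos by (simp add: U_def)

lemma U_cos: "U \<phi> = (1 / r1\<^sup>2 + 1 / r0\<^sup>2 - K * cos (2 * \<phi>)) / 2"
proof -
  have "c * y + (1 - c) * x = (y + x - (x - y) * (2 * c - 1)) / 2" for c x y :: real
    by (simp add: field_simps)
  from this[of "(cos \<phi>)\<^sup>2" "1 / r1\<^sup>2" "1 / r0\<^sup>2"] show ?thesis
    unfolding U_def K_def cos_double_cos sin_squared_eq by simp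
qed

text \<open>The zeros \<open>1 / r1\<^sup>2\<close> and \<open>1 / r0\<^sup>2\<close> of
  \<open>Q\<close> correspond to \<open>c = 1\<close> and \<open>c = -1\<close>. For
  \<open>c = cos (2 * \<phi>)\<close> the argument of \<open>Q\<close> is
  \<open>U \<phi>\<close>.\<close>

lemma Q_affine: "Q ((1 / r1\<^sup>2 + 1 / r0\<^sup>2 - K * c) / 2) = K\<^sup>2 * (1 - c\<^sup>2)"
proof -
  have "4 * (x - (y + x - (x - y) * c) / 2) * ((y + x - (x - y) * c) / 2 - y) = (x - y)\<^sup>2 * (1 - c\<^sup>2)"
    for x y :: real
    by (simp add: field_simps power2_eq_square)
  then show ?thesis
    unfolding Q_def K_def by blast
qed

lemma Q_U: "Q (U \<phi>) = (K * sin (2 * \<phi>))\<^sup>2"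
  unfolding U_cos Q_affine by (simp add: sin_squared_eq power_mult_distrib)

text \<open>A zero of \<open>D\<close> is \<open>u = - 1 / (r0 * r1)\<close>, which is positive only
  for negative \<open>r0\<close>. It is then the geometric mean of the two zeros of
  \<open>Q\<close>, so it lies strictly between them, where \<open>Q\<close> is positive. Hence
  points with vanishing angular velocity are never apsides.\<close>

lemma D_eq_0D:
  assumes "u > 0" "D u = 0"
  shows "r0 < 0" "Q u > 0"
proof -
  have "b + a * u > 0"
    using assms a_pos b_pos by (simp add: add_pos_pos)
  then have u: "r0 * r1 * u = - 1"
    using assms r0_nz r1_pos a_pos by (simp add: D_def)
  show r0: "r0 < 0"
  proof (rule ccontr)
    assume "\<not> r0 < 0"
    then have "r0 * r1 * u > 0"
      using r0_nz r1_pos assms(1) by simp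
    then show False
      using u by simp
  qed
  have "u = - 1 / (r0 * r1)"
    using u r0_nz r1_pos by (simp add: field_simps)
  then have "Q u = 4 * (r1 + r0)\<^sup>2 / ((- r0) * r1) ^ 3"
    using r0_nz r1_pos unfolding Q_def by (simp add: field_simps) algebra
  moreover have "0 < ((- r0) * r1) ^ 3"
    using mult_neg_pos[OF r0 r1_pos] by (intro zero_less_power) simp
  moreover have "0 < 4 * (r1 + r0)\<^sup>2"
    using r0_r1 by simp
  ultimately show "Q u > 0"
    by (simp only: divide_pos_pos)
qed

lemma has_real_derivative_D:
  assumes "u > 0"
  shows "(D has_real_derivative a * (b * (r0 * r1) - a) / (r0 * r1 * (b + a * u)\<^sup>2)) (at u)"
proof -
  have "b + a * u > 0"
    using assms a_pos b_pos by (simp add: add_pos_pos)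
  then show ?thesis
    using r0_nz r1_pos unfolding D_def
    by (auto intro!: derivative_eq_intros simp: power2_eq_square divide_simps) algebra
qed

lemma C1_differentiable_on_D:
  assumes "f C1_differentiable_on S" "\<And>t. t \<in> S \<Longrightarrow> f t > 0"
  shows "(\<lambda>t. D (f t)) C1_differentiable_on S"
proof -
  have "r0 * r1 * (b + a * f t) \<noteq> 0" if "t \<in> S" for t
    using assms(2)[OF that] a_pos b_pos r0_nz r1_pos by (smt (verit) mult_eq_0_iff mult_pos_pos)
  with assms(1) show ?thesis
    unfolding D_def by (intro C1_intros) auto
qed

text \<open>\<open>Re m\<close> is the relative rate of the radius and \<open>Im m\<close> the
  angular velocity. Hence \<open>p = r * Im m / norm m\<close>, and
  \<open>1 / p\<^sup>2 - 1 / r\<^sup>2\<close> is the square of \<open>Re m / (r * Im m)\<close> if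
  \<open>Im m\<close> is nonzero. Since \<open>u' = - 2 * u * Re m\<close>, the right-hand side is
  the equation in \<open>u\<close>, free of divisions by \<open>p\<close>.\<close>

lemma pedal_eq_iff:
  fixes \<gamma> :: "real \<Rightarrow> complex"
  assumes "\<gamma> t \<noteq> 0" and vel: "velocity \<gamma> t = \<gamma> t * m" and "m \<noteq> 0" and u: "u = 1 / (norm (\<gamma> t))\<^sup>2"
  shows "linkage_pedal_eq r0 r1 a b (pedal_r \<gamma> t) (pedal_p \<gamma> t)
    \<longleftrightarrow> (D u * (2 * u * Re m))\<^sup>2 = (Im m)\<^sup>2 * Q u"
proof -
  define r where "r = norm (\<gamma> t)"
  have r: "r > 0" using assms(1) by (simp add: r_def)
  have inner: "(\<i> * \<gamma> t) \<bullet> (\<gamma> t * m) = r\<^sup>2 * Im m"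
    by (simp add: inner_complex_def r_def cmod_power2) algebra
  have p: "pedal_p \<gamma> t = r * Im m / norm m"
    unfolding pedal_p_def vel inner using r by (simp add: norm_mult power2_eq_square flip: r_def)
  have pr: "pedal_r \<gamma> t = r" by (simp add: pedal_r_def r_def)
  have nm: "(norm m)\<^sup>2 = (Re m)\<^sup>2 + (Im m)\<^sup>2" "norm m \<noteq> 0"
    using assms(3) by (simp_all add: cmod_power2)
  have "linkage_pedal_eq r0 r1 a b (pedal_r \<gamma> t) (pedal_p \<gamma> t)
      \<longleftrightarrow> a\<^sup>2 * (r\<^sup>2 + r0 * r1)\<^sup>2 * (Re m)\<^sup>2
        = (Im m)\<^sup>2 * ((r\<^sup>2 - r0\<^sup>2) * (r1\<^sup>2 - r\<^sup>2) * (b * r\<^sup>2 + a)\<^sup>2)"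
  proof (cases "Im m = 0")
    \<comment> \<open>Here \<open>p = 0\<close>, and \<open>Re m\<close> is nonzero, so that both
      conditions say that the coefficient of \<open>1 / p\<^sup>2\<close> vanishes.\<close>
    case True
    then have "Re m \<noteq> 0" using assms(3) by (simp add: complex_eq_iff)
    then show ?thesis
      using True r by (simp add: linkage_pedal_eq_def p pr)
  next
    case False
    then have pn: "pedal_p \<gamma> t \<noteq> 0" using p r nm(2) by simp
    have eq: "1 / (pedal_p \<gamma> t)\<^sup>2 - 1 / r\<^sup>2 = (Re m)\<^sup>2 / ((Im m)\<^sup>2 * r\<^sup>2)"
      using False r nm(2) unfolding p by (simp add: power_divide power_mult_distrib nm(1) field_simps)
    show ?thesis
      using pn r False unfolding linkage_pedal_eq_def pr eq by (simp add: field_simps)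
  qed
  also have "\<dots> \<longleftrightarrow> (D u * (2 * u * Re m))\<^sup>2 = (Im m)\<^sup>2 * Q u"
  proof -
    define w where "w = r\<^sup>2"
    have w: "w > 0" using r by (simp add: w_def)
    have uw: "u = 1 / w" by (simp add: u w_def r_def)
    have bw: "b * w + a > 0" using w a_pos b_pos by (simp add: add_pos_pos)
    \<comment> \<open>This factor clears the denominators of both sides at once.\<close>
    define k where "k = w\<^sup>2 * (r0 * r1)\<^sup>2 * (b * w + a)\<^sup>2 / 4"
    have k: "k \<noteq> 0" using w bw r0_nz r1_pos by (simp add: k_def)
    have "D u = a * (w + r0 * r1) / (r0 * r1 * (b * w + a))"
      using w bw r0_nz r1_pos unfolding D_def uw by (simp add: divide_simps)
    then have "k * (D u * (2 * u * Re m))\<^sup>2 = a\<^sup>2 * (w + r0 * r1)\<^sup>2 * (Re m)\<^sup>2"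
      using w bw r0_nz r1_pos
      by (simp add: k_def uw power_mult_distrib power_divide)
    moreover have "Q u = 4 * (w - r0\<^sup>2) * (r1\<^sup>2 - w) / (w\<^sup>2 * (r0 * r1)\<^sup>2)"
      using w r0_nz r1_pos unfolding Q_def uw by (simp add: divide_simps) algebra
    then have "k * ((Im m)\<^sup>2 * Q u) = (Im m)\<^sup>2 * ((w - r0\<^sup>2) * (r1\<^sup>2 - w) * (b * w + a)\<^sup>2)"
      using w bw r0_nz r1_pos by (simp add: k_def) (simp add: algebra_simps)
    ultimately show ?thesis
      using k by (metis mult_left_cancel w_def)
  qed
  finally show ?thesis .
qed

end

section \<open>Logarithmic derivatives of curves\<close>

text \<open>The smoothness is gained in two rounds: \<open>\<gamma> * m\<close> is continuous, so
  \<open>\<gamma>\<close> is of class C1, and then the velocity \<open>\<gamma> * m\<close> is a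
  product of C1 functions.\<close>

lemma regular_C2_curve_if_log_derivative:
  assumes I: "open I" "is_interval I"
    and \<gamma>: "\<And>t. t \<in> I \<Longrightarrow> (\<gamma> has_vector_derivative \<gamma> t * m t) (at t)"
    and m: "m C1_differentiable_on I" "\<And>t. t \<in> I \<Longrightarrow> m t \<noteq> 0" and nz: "\<And>t. t \<in> I \<Longrightarrow> \<gamma> t \<noteq> 0"
  shows "regular_C2_curve \<gamma> I" and "\<And>t. t \<in> I \<Longrightarrow> velocity \<gamma> t = \<gamma> t * m t"
proof -
  show vel: "velocity \<gamma> t = \<gamma> t * m t" if "t \<in> I" for t
    using \<gamma>[OF that] by (simp add: velocity_def vector_derivative_at)
  have "continuous_on I \<gamma>"
    using \<gamma> by (meson continuous_at_imp_continuous_on has_vector_derivative_continuous)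
  then have C1: "\<gamma> C1_differentiable_on I"
    unfolding C1_differentiable_on_def using \<gamma> C1_differentiable_on_continuous[OF m(1)]
    by (intro exI[of _ "\<lambda>t. \<gamma> t * m t"]) (auto intro: continuous_on_mult)
  have "velocity \<gamma> C1_differentiable_on I"
    by (rule C1_differentiable_on_cong[OF I(1) _ C1_differentiable_on_mult[OF C1 m(1)]])
       (simp add: vel)
  then show "regular_C2_curve \<gamma> I"
    using I C1 m(2) nz vel by (simp add: regular_C2_curve_def)
qed

lemma regular_C2_curve_log_derivative:
  assumes \<gamma>: "regular_C2_curve \<gamma> I" and nz: "\<And>t. t \<in> I \<Longrightarrow> \<gamma> t \<noteq> 0"
  obtains m where "m C1_differentiable_on I"
    and "\<And>t. t \<in> I \<Longrightarrow> (\<gamma> has_vector_derivative \<gamma> t * m t) (at t)"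
    and "\<And>t. t \<in> I \<Longrightarrow> velocity \<gamma> t = \<gamma> t * m t" and "\<And>t. t \<in> I \<Longrightarrow> m t \<noteq> 0"
proof -
  \<comment> \<open>This is the velocity divided by \<open>\<gamma>\<close>, written with the
    conjugate and a real reciprocal because the quotient rule for C1 functions above is for real
    functions.\<close>
  define m where "m t = velocity \<gamma> t * cnj (\<gamma> t) * of_real (1 / ((Re (\<gamma> t))\<^sup>2 + (Im (\<gamma> t))\<^sup>2))" for t
  have C1: "\<gamma> C1_differentiable_on I" "velocity \<gamma> C1_differentiable_on I"
    and v: "\<And>t. t \<in> I \<Longrightarrow> velocity \<gamma> t \<noteq> 0"
    using \<gamma> by (auto simp: regular_C2_curve_def)
  have pos: "(Re (\<gamma> t))\<^sup>2 + (Im (\<gamma> t))\<^sup>2 \<noteq> 0" if "t \<in> I" for t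
    using nz[OF that] complex_neq_0 by force
  have m: "m C1_differentiable_on I"
    unfolding m_def using pos by (intro C1_intros C1) auto
  have vel: "velocity \<gamma> t = \<gamma> t * m t" if "t \<in> I" for t
  proof -
    define d where "d = (Re (\<gamma> t))\<^sup>2 + (Im (\<gamma> t))\<^sup>2"
    have d: "d \<noteq> 0" "\<gamma> t * cnj (\<gamma> t) = of_real d"
      using pos[OF that] by (simp_all only: d_def complex_mult_cnj not_False_eq_True)
    have "\<gamma> t * m t = velocity \<gamma> t * (\<gamma> t * cnj (\<gamma> t)) * of_real (1 / d)"
      unfolding m_def d_def by (simp only: mult_ac)
    also have "\<dots> = velocity \<gamma> t"
      unfolding d(2) using d(1) by simp
    finally show ?thesis ..
  qed
  have "(\<gamma> has_vector_derivative velocity \<gamma> t) (at t)" if "t \<in> I" for t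
    using C1(1) that unfolding velocity_def C1_differentiable_on_eq by (simp add: vector_derivative_works)
  then show ?thesis
    using that[of m] m vel v by (metis mult_zero_right)
qed

text \<open>The quotient of the two curves has derivative zero. This is the uniqueness argument that
  identifies a solution with the ellipse in GRFR up to a complex constant.\<close>

lemma proportional_if_log_derivative_eq:
  fixes \<gamma> \<eta> :: "real \<Rightarrow> complex"
  assumes I: "is_interval I"
    and \<gamma>: "\<And>t. t \<in> I \<Longrightarrow> (\<gamma> has_vector_derivative \<gamma> t * m t) (at t)"
    and \<eta>: "\<And>t. t \<in> I \<Longrightarrow> (\<eta> has_vector_derivative \<eta> t * m t) (at t)"
    and nz: "\<And>t. t \<in> I \<Longrightarrow> \<eta> t \<noteq> 0"
  obtains c where "\<And>t. t \<in> I \<Longrightarrow> \<gamma> t = c * \<eta> t"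
proof -
  have "((\<lambda>t. \<gamma> t * inverse (\<eta> t)) has_vector_derivative 0) (at t)" if "t \<in> I" for t
  proof -
    have "(inverse has_field_derivative - (inverse (\<eta> t) * inverse (\<eta> t))) (at (\<eta> t))"
      using nz[OF that] by (auto intro!: derivative_eq_intros simp: power2_eq_square)
    from field_vector_diff_chain_at[OF \<eta>[OF that] this]
    have "((\<lambda>t. inverse (\<eta> t)) has_vector_derivative - (inverse (\<eta> t) * m t)) (at t)"
      using nz[OF that] by (simp add: o_def field_simps)
    from has_vector_derivative_mult[OF \<gamma>[OF that] this] show ?thesis
      by (simp add: algebra_simps)
  qed
  then obtain c where "\<And>t. t \<in> I \<Longrightarrow> \<gamma> t * inverse (\<eta> t) = c"
    using has_vector_derivative_zero_constant[of I "\<lambda>t. \<gamma> t * inverse (\<eta> t)"] I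
    by (metis has_vector_derivative_at_within is_interval_convex)
  then show ?thesis
    using that[of c] nz by (metis (no_types) mult.assoc left_inverse mult.right_neutral)
qed

section \<open>The ellipse in GRFR\<close>

context linkage_pedal
begin

text \<open>Logarithmic derivative, with respect to \<phi>, of a curve with radius
  \<open>1 / sqrt (U \<phi>)\<close> and angular velocity \<open>D (U \<phi>)\<close>.\<close>

definition L :: "real \<Rightarrow> complex" where
  "L \<phi> = of_real (- (K * sin (2 * \<phi>)) / (2 * U \<phi>)) + \<i> * of_real (D (U \<phi>))"

lemma has_real_derivative_U: "(U has_real_derivative K * sin (2 * \<phi>)) (at \<phi>)"
proof -
  have "((\<lambda>\<phi>. (cos \<phi>)\<^sup>2 * y + (sin \<phi>)\<^sup>2 * x) has_real_derivative (x - y) * sin (2 * \<phi>)) (at \<phi>)"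
    for x y :: real
    unfolding sin_double by (auto intro!: derivative_eq_intros simp: algebra_simps)
  from this[of "1 / r1\<^sup>2" "1 / r0\<^sup>2"] show ?thesis
    unfolding U_def[abs_def] K_def by simp
qed

lemma C1_differentiable_on_U: "f C1_differentiable_on S \<Longrightarrow> (\<lambda>t. U (f t)) C1_differentiable_on S"
  using r0_nz r1_pos unfolding U_def by (intro C1_intros) auto

lemma C1_differentiable_on_L:
  assumes "f C1_differentiable_on S"
  shows "(\<lambda>t. L (f t)) C1_differentiable_on S"
proof -
  have "2 * U \<phi> \<noteq> 0" for \<phi> using U_pos[of \<phi>] by simp
  then show ?thesis
    unfolding L_def by (intro C1_intros C1_differentiable_on_D C1_differentiable_on_U assms U_pos)
qed

text \<open>A zero of \<open>L\<close> would be an apsis at which \<open>D\<close> vanishes as well,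
  which \<open>D_eq_0D\<close> rules out.\<close>

lemma L_nz: "L \<phi> \<noteq> 0"
proof
  assume "L \<phi> = 0"
  then have "Re (L \<phi>) = 0" "Im (L \<phi>) = 0" by simp_all
  then have "K * sin (2 * \<phi>) = 0" "D (U \<phi>) = 0"
    using U_pos[of \<phi>] by (simp_all add: L_def)
  then show False
    using D_eq_0D(2)[OF U_pos, of \<phi>] by (simp add: Q_U)
qed

lemma ellipse_polar_radius_U: "ellipse_polar_radius r1 \<bar>r0\<bar> \<phi> = 1 / sqrt (U \<phi>)"
proof -
  have "U \<phi> = (\<bar>r0\<bar>\<^sup>2 * (cos \<phi>)\<^sup>2 + r1\<^sup>2 * (sin \<phi>)\<^sup>2) / (r1 * \<bar>r0\<bar>)\<^sup>2"
    using r0_nz r1_pos unfolding U_def power_mult_distrib by (simp add: field_simps)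
  then have "sqrt (U \<phi>) = sqrt (\<bar>r0\<bar>\<^sup>2 * (cos \<phi>)\<^sup>2 + r1\<^sup>2 * (sin \<phi>)\<^sup>2) / (r1 * \<bar>r0\<bar>)"
    using r1_pos by (simp add: real_sqrt_divide)
  then show ?thesis
    by (simp add: ellipse_polar_radius_def)
qed

end

text \<open>The assumption \<open>rate\<close> relates the ellipse of rotation to the pedal
  equation: it says that the rotated polar angle has derivative \<open>D (U \<phi>)\<close> with
  respect to \<phi>, which also fixes the sense of rotation if the ellipse of rotation is not
  degenerate.\<close>

locale linkage_grfr = linkage_pedal +
  fixes \<sigma> A B :: real
  assumes AB: "A > 0 \<and> B > 0 \<or> A = 0 \<and> B = 0"
    and rate: "1 + \<sigma> * (A * B / 2) * rot_ellipse_rate B A \<phi> = D (U \<phi>)"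
begin

text \<open>The ellipse in GRFR, parametrized by the polar angle on the original ellipse.\<close>

definition curve :: "real \<Rightarrow> complex" where
  "curve \<phi> = of_real (1 / sqrt (U \<phi>)) * cis (\<phi> + \<sigma> * swept_area A B (rot_ellipse_angle B A \<phi>))"

lemma BA: "B > 0 \<and> A > 0 \<or> B = 0 \<and> A = 0"
  using AB by blast

lemma grfr_ellipse_eq: "grfr_ellipse \<sigma> r1 \<bar>r0\<bar> A B t = curve (rot_ellipse_angle A B t)"
  by (simp add: grfr_ellipse_def curve_def Let_def ellipse_polar_radius_U rot_ellipse_angle_inverse[OF AB])

lemma norm_curve: "norm (curve \<phi>) = 1 / sqrt (U \<phi>)"
  using U_pos[of \<phi>] by (simp add: curve_def norm_mult norm_divide)

lemma curve_nz: "curve \<phi> \<noteq> 0"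
  using U_pos[of \<phi>] norm_curve[of \<phi>] by force

lemma has_vector_derivative_curve: "(curve has_vector_derivative curve \<phi> * L \<phi>) (at \<phi>)"
proof -
  define \<Theta> where "\<Theta> \<phi> = \<phi> + \<sigma> * swept_area A B (rot_ellipse_angle B A \<phi>)" for \<phi>
  define R where "R \<phi> = 1 / sqrt (U \<phi>)" for \<phi>
  have "(\<Theta> has_real_derivative 1 + \<sigma> * (A * B / 2) * rot_ellipse_rate B A \<phi>) (at \<phi>)"
    unfolding \<Theta>_def swept_area_def
    by (auto intro!: derivative_eq_intros has_real_derivative_rot_ellipse_angle BA)
  then have \<Theta>: "(\<Theta> has_vector_derivative D (U \<phi>)) (at \<phi>)"
    by (simp only: rate has_real_derivative_iff_has_vector_derivative)
  have "(cis has_vector_derivative \<i> * cis x) (at x)" for x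
    unfolding cis_conv_exp
    by (rule has_vector_derivative_real_field) (auto intro!: derivative_eq_intros)
  from vector_diff_chain_at[OF \<Theta> this]
  have cis: "((\<lambda>\<phi>. cis (\<Theta> \<phi>)) has_vector_derivative of_real (D (U \<phi>)) * (\<i> * cis (\<Theta> \<phi>))) (at \<phi>)"
    by (simp add: o_def scaleR_conv_of_real)
  have "(R has_real_derivative R \<phi> * (- (K * sin (2 * \<phi>)) / (2 * U \<phi>))) (at \<phi>)"
    unfolding R_def using U_pos[of \<phi>]
    by (auto intro!: derivative_eq_intros has_real_derivative_U simp: field_simps)
  then have "((\<lambda>\<phi>. of_real (R \<phi>) :: complex) has_vector_derivative
      of_real (R \<phi> * (- (K * sin (2 * \<phi>)) / (2 * U \<phi>)))) (at \<phi>)"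
    by (rule has_vector_derivative_of_real)
  from has_vector_derivative_mult[OF this cis] show ?thesis
    unfolding curve_def[abs_def] L_def R_def[symmetric] \<Theta>_def[symmetric]
    by (simp add: algebra_simps)
qed

text \<open>By the chain rule the logarithmic derivative is \<open>L\<close> times the rate of the
  polar angle. Both sides of the equation in \<open>pedal_eq_iff\<close> then are the square of the
  product of \<open>D (U \<phi>)\<close>, \<open>K * sin (2 * \<phi>)\<close> and this rate.\<close>

lemma satisfies_grfr_ellipse:
  "satisfies_pedal_eq (linkage_pedal_eq r0 r1 a b) (grfr_ellipse \<sigma> r1 \<bar>r0\<bar> A B) UNIV"
proof -
  let ?\<gamma> = "grfr_ellipse \<sigma> r1 \<bar>r0\<bar> A B"
  define m where "m t = L (rot_ellipse_angle A B t) * of_real (rot_ellipse_rate A B t)" for t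
  have m: "m C1_differentiable_on UNIV"
    unfolding m_def
    by (intro C1_intros C1_differentiable_on_L C1_differentiable_on_rot_ellipse_angle
        C1_differentiable_on_rot_ellipse_rate AB)
  have m_nz: "m t \<noteq> 0" for t
    using L_nz rot_ellipse_rate_pos[OF AB, of t] by (simp add: m_def)
  have nz: "?\<gamma> t \<noteq> 0" for t
    by (simp add: grfr_ellipse_eq curve_nz)
  have "(?\<gamma> has_vector_derivative ?\<gamma> t * m t) (at t)" for t
    using vector_diff_chain_at[OF has_real_derivative_rot_ellipse_angle[OF AB,
          unfolded has_real_derivative_iff_has_vector_derivative] has_vector_derivative_curve, of t]
    by (simp add: o_def m_def scaleR_conv_of_real mult_ac flip: grfr_ellipse_eq)
  note reg = regular_C2_curve_if_log_derivative[OF open_UNIV is_interval_univ this m m_nz nz]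
  have "linkage_pedal_eq r0 r1 a b (pedal_r ?\<gamma> t) (pedal_p ?\<gamma> t)" for t
  proof -
    define \<phi> where "\<phi> = rot_ellipse_angle A B t"
    have U: "U \<phi> = 1 / (norm (?\<gamma> t))\<^sup>2"
      using U_pos[of \<phi>] by (simp add: grfr_ellipse_eq norm_curve power_divide flip: \<phi>_def)
    have "2 * U \<phi> * Re (m t) = - (K * sin (2 * \<phi>)) * rot_ellipse_rate A B t"
      using U_pos[of \<phi>] by (simp add: m_def L_def flip: \<phi>_def)
    moreover have "Im (m t) = D (U \<phi>) * rot_ellipse_rate A B t"
      by (simp add: m_def L_def flip: \<phi>_def)
    ultimately show ?thesis
      by (subst pedal_eq_iff[OF nz reg(2)[OF UNIV_I] m_nz U]) (simp add: Q_U power_mult_distrib)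
  qed
  then show ?thesis
    using reg(1) by (simp add: satisfies_pedal_eq_def)
qed

end

section \<open>Solutions of the pedal equation\<close>

text \<open>At a zero of \<open>D\<close> the value of \<open>Q\<close> is positive. Elsewhere
  \<open>w = 0\<close> would force \<open>u' = 0\<close>, so \<open>w\<close> is nonzero and the
  equation makes \<open>Q u\<close> nonnegative. The sum is the squared length of the vector
  \<open>(K sin 2\<phi>, D u)\<close> if \<open>u = U \<phi>\<close>.\<close>

lemma (in linkage_pedal) Q_plus_D_pos:
  assumes "u > 0" "u' \<noteq> 0 \<or> w \<noteq> 0" and eq: "(D u * u')\<^sup>2 = w\<^sup>2 * Q u"
  shows "Q u + (D u)\<^sup>2 > 0"
proof (cases "D u = 0")
  case True
  then show ?thesis using D_eq_0D(2)[OF assms(1)] by simp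
next
  case False
  then have "w \<noteq> 0" using assms(2) eq by auto
  moreover have "w\<^sup>2 * Q u \<ge> 0" unfolding eq[symmetric] by simp
  ultimately have "Q u \<ge> 0" by (simp add: zero_le_mult_iff)
  then show ?thesis using False by (simp add: add_nonneg_pos)
qed

text \<open>Along a solution, \<open>(u', w)\<close> has to be a multiple \<open>q\<close> of \<open>(K sin 2\<phi>, D u)\<close>, where \<open>u = U \<phi>\<close>; this
  determines \<open>\<bar>q\<bar>\<close>, and the sign of \<open>q\<close> cannot change at a zero of \<open>D u\<close> because there both
  \<open>w = q * D u\<close> and its derivative are continuous.\<close>

lemma (in linkage_pedal) signed_rate:
  assumes I: "open I" "connected I"
    and u: "\<And>t. t \<in> I \<Longrightarrow> u t > 0" "\<And>t. t \<in> I \<Longrightarrow> (u has_real_derivative u' t) (at t)"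
    and C1: "u' C1_differentiable_on I" "w C1_differentiable_on I"
    and nz: "\<And>t. t \<in> I \<Longrightarrow> u' t \<noteq> 0 \<or> w t \<noteq> 0"
    and eq: "\<And>t. t \<in> I \<Longrightarrow> (D (u t) * u' t)\<^sup>2 = (w t)\<^sup>2 * Q (u t)"
  obtains q where "q C1_differentiable_on I" "\<And>t. t \<in> I \<Longrightarrow> q t \<noteq> 0"
    "\<And>t. t \<in> I \<Longrightarrow> w t = D (u t) * q t" "\<And>t. t \<in> I \<Longrightarrow> (u' t)\<^sup>2 = Q (u t) * (q t)\<^sup>2"
proof -
  \<comment> \<open>The quotient of the squared lengths of \<open>(u', w)\<close> and
    \<open>(K sin 2\<phi>, D u)\<close> is the square of the rate; \<open>s\<close> is its absolute
    value. The positive denominator makes \<open>s\<close> of class C1 even where \<open>D u\<close>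
    or \<open>Q u\<close> vanishes.\<close>
  define s where "s t = sqrt (((u' t)\<^sup>2 + (w t)\<^sup>2) / (Q (u t) + (D (u t))\<^sup>2))" for t
  have QD: "Q (u t) + (D (u t))\<^sup>2 > 0" if "t \<in> I" for t
    using Q_plus_D_pos[OF u(1) nz eq] that by blast
  have num: "(u' t)\<^sup>2 + (w t)\<^sup>2 > 0" if "t \<in> I" for t
    using nz[OF that] by (auto simp: add_pos_nonneg add_nonneg_pos)
  have uC1: "u C1_differentiable_on I"
    unfolding C1_differentiable_on_def
    using u(2) C1_differentiable_on_continuous[OF C1(1)]
    by (auto simp: has_real_derivative_iff_has_vector_derivative)
  have QC1: "(\<lambda>t. Q (u t)) C1_differentiable_on I"
    unfolding Q_def by (intro C1_intros uC1)
  have DC1: "(\<lambda>t. D (u t)) C1_differentiable_on I"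
    by (intro C1_differentiable_on_D uC1 u(1))
  have sC1: "s C1_differentiable_on I"
    unfolding s_def
    by (intro C1_intros C1 QC1 DC1 divide_pos_pos num QD less_imp_neq[OF QD, symmetric])
  have s_pos: "s t > 0" if "t \<in> I" for t
    using QD[OF that] num[OF that] by (simp add: s_def)
  have s2: "(s t)\<^sup>2 * (Q (u t) + (D (u t))\<^sup>2) = (u' t)\<^sup>2 + (w t)\<^sup>2" if "t \<in> I" for t
    using QD[OF that] num[OF that] by (simp add: s_def)
  have w2: "(w t)\<^sup>2 = (D (u t) * s t)\<^sup>2" and u2: "(u' t)\<^sup>2 = Q (u t) * (s t)\<^sup>2" if "t \<in> I" for t
  proof -
    have "(Q (u t) + (D (u t))\<^sup>2) * (w t)\<^sup>2 = (Q (u t) + (D (u t))\<^sup>2) * (D (u t) * s t)\<^sup>2"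
      "(Q (u t) + (D (u t))\<^sup>2) * (u' t)\<^sup>2 = (Q (u t) + (D (u t))\<^sup>2) * (Q (u t) * (s t)\<^sup>2)"
      using eq[OF that] s2[OF that] by algebra+
    then show "(w t)\<^sup>2 = (D (u t) * s t)\<^sup>2" "(u' t)\<^sup>2 = Q (u t) * (s t)\<^sup>2"
      using QD[OF that] by auto
  qed
  \<comment> \<open>The two possible signs of the rate correspond to \<open>f = 0\<close> and
    \<open>g = 0\<close>. The product of both is zero, and one sign has to be found for the whole
    interval.\<close>
  define f where "f t = w t - D (u t) * s t" for t
  define g where "g t = w t + D (u t) * s t" for t
  have fC1: "f C1_differentiable_on I" and gC1: "g C1_differentiable_on I"
    unfolding f_def g_def by (intro C1_intros C1 DC1 sC1)+
  have "(\<forall>t\<in>I. f t = 0) \<or> (\<forall>t\<in>I. g t = 0)"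
  proof (rule factor_zero_if_mult_zero_C1[OF I])
    show "f t * g t = 0" if "t \<in> I" for t
      using w2[OF that] unfolding f_def g_def by algebra
    show "(f has_real_derivative deriv f t) (at t)" "(g has_real_derivative deriv g t) (at t)"
      if "t \<in> I" for t
      using fC1 gC1 C1_differentiable_on_imp_deriv(1) that by blast+
    show "continuous_on I (deriv f)" "continuous_on I (deriv g)"
      using fC1 gC1 C1_differentiable_on_imp_deriv(2) by blast+
    show "deriv f t \<noteq> 0 \<or> deriv g t \<noteq> 0" if t: "t \<in> I" and "f t = 0" "g t = 0" for t
    proof (rule ccontr)
      assume "\<not> (deriv f t \<noteq> 0 \<or> deriv g t \<noteq> 0)"
      moreover have "(f has_real_derivative deriv f t) (at t)" "(g has_real_derivative deriv g t) (at t)"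
        using fC1 gC1 C1_differentiable_on_imp_deriv(1) t by blast+
      \<comment> \<open>If both derivatives vanished, so would that of \<open>g - f\<close>, which
        at a zero of \<open>D u\<close> is \<open>2 * D' * u' * s\<close>. But \<open>D'\<close> is
        nonzero because \<open>r0\<close> is negative there, and \<open>u'\<close> is nonzero
        because \<open>w\<close> vanishes.\<close>
      ultimately have "((\<lambda>t. g t - f t) has_real_derivative 0 - 0) (at t)"
        by (intro DERIV_diff) auto
      moreover have "(\<lambda>t. g t - f t) = (\<lambda>t. 2 * (D (u t) * s t))"
        by (simp add: f_def g_def mult.commute)
      ultimately have 0: "((\<lambda>t. 2 * (D (u t) * s t)) has_real_derivative 0) (at t)"
        by simp
      have D0: "D (u t) = 0" and w0: "w t = 0"
        using that s_pos[OF t] by (auto simp: f_def g_def)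
      define D' where "D' = a * (b * (r0 * r1) - a) / (r0 * r1 * (b + a * u t)\<^sup>2)"
      have "((\<lambda>t. 2 * (D (u t) * s t)) has_real_derivative
          2 * (D' * u' t * s t + deriv s t * D (u t))) (at t)"
        unfolding D'_def
        by (intro DERIV_cmult DERIV_mult DERIV_chain2[where f = D] has_real_derivative_D u t
            C1_differentiable_on_imp_deriv(1)[OF sC1])
      from DERIV_unique[OF this 0] have "D' * u' t = 0"
        using s_pos[OF t] by (simp add: D0)
      moreover have "b * (r0 * r1) < 0"
        using D_eq_0D(1)[OF u(1)[OF t] D0] b_pos r1_pos by (simp add: mult_pos_neg mult_neg_pos)
      then have "D' \<noteq> 0"
        using a_pos r0_nz r1_pos add_pos_pos[OF b_pos mult_pos_pos[OF a_pos u(1)[OF t]]]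
        by (simp add: D'_def)
      ultimately show False
        using nz[OF t] w0 by simp
    qed
  qed
  then obtain \<epsilon> :: real where \<epsilon>: "\<epsilon> = 1 \<or> \<epsilon> = -1" "\<And>t. t \<in> I \<Longrightarrow> w t = D (u t) * (\<epsilon> * s t)"
    by (elim disjE) (force simp: f_def g_def)+
  show ?thesis
  proof (rule that[of "\<lambda>t. \<epsilon> * s t"])
    show "(\<lambda>t. \<epsilon> * s t) C1_differentiable_on I"
      by (intro C1_intros sC1)
    show "\<epsilon> * s t \<noteq> 0" if "t \<in> I" for t
      using \<epsilon>(1) s_pos[OF that] by auto
    show "(u' t)\<^sup>2 = Q (u t) * (\<epsilon> * s t)\<^sup>2" if "t \<in> I" for t
      using \<epsilon>(1) u2[OF that] by auto
  qed (rule \<epsilon>(2))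
qed

text \<open>The angle \<open>\<phi>\<close> is recovered from its rate \<open>q\<close> and from \<open>C = cos 2\<phi>\<close> and \<open>S = sin 2\<phi>\<close>. Here
  \<open>S (S' - 2 q C) = 0\<close>, and the second factor is the one that vanishes as \<open>u\<close> is not constant: this
  excludes that a solution stays on a circle at an apsis.\<close>

lemma (in linkage_pedal) angle_exists:
  assumes I: "open I" "is_interval I"
    and u': "\<And>t. t \<in> I \<Longrightarrow> (u has_real_derivative u' t) (at t)" "u' C1_differentiable_on I"
    and q: "q C1_differentiable_on I" "\<And>t. t \<in> I \<Longrightarrow> q t \<noteq> 0"
    and eq: "\<And>t. t \<in> I \<Longrightarrow> (u' t)\<^sup>2 = Q (u t) * (q t)\<^sup>2"
    and nonconst: "\<not> u constant_on I"
  obtains \<phi> where "\<And>t. t \<in> I \<Longrightarrow> (\<phi> has_real_derivative q t) (at t)"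
    "\<And>t. t \<in> I \<Longrightarrow> u t = U (\<phi> t)" "\<And>t. t \<in> I \<Longrightarrow> u' t = K * sin (2 * \<phi> t) * q t"
proof -
  have con: "connected I"
    using I(2) by (simp add: is_interval_connected)
  obtain t0 where t0: "t0 \<in> I"
    using nonconst by (auto simp: constant_on_def)
  \<comment> \<open>\<open>C\<close> and \<open>S\<close> are found by solving
    \<open>u = U \<phi>\<close> for \<open>cos (2 * \<phi>)\<close> and
    \<open>u' = K * sin (2 * \<phi>) * q\<close> for \<open>sin (2 * \<phi>)\<close>.\<close>
  define C where "C t = (1 / r1\<^sup>2 + 1 / r0\<^sup>2 - 2 * u t) / K" for t
  define S where "S t = u' t / (K * q t)" for t
  have u_C: "u t = (1 / r1\<^sup>2 + 1 / r0\<^sup>2 - K * C t) / 2" for t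
    using K_pos by (simp add: C_def)
  have u'_S: "u' t = K * S t * q t" if "t \<in> I" for t
    using K_pos q(2)[OF that] by (simp add: S_def)
  have CS: "(C t)\<^sup>2 + (S t)\<^sup>2 = 1" if "t \<in> I" for t
  proof -
    have "(K * q t)\<^sup>2 * (S t)\<^sup>2 = (u' t)\<^sup>2"
      using u'_S[OF that] by (simp add: power_mult_distrib)
    also have "\<dots> = (K * q t)\<^sup>2 * (1 - (C t)\<^sup>2)"
      unfolding eq[OF that] u_C[of t] Q_affine by (simp add: power_mult_distrib)
    finally show ?thesis
      using K_pos q(2)[OF that] by simp
  qed
  have C': "(C has_real_derivative - 2 * q t * S t) (at t)" if "t \<in> I" for t
  proof -
    have "(C has_real_derivative (- 2 * u' t) / K) (at t)"
      unfolding C_def[abs_def] using K_pos by (auto intro!: derivative_eq_intros u'(1) that)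
    then show ?thesis
      using K_pos q(2)[OF that] by (simp add: S_def)
  qed
  have SC1: "S C1_differentiable_on I"
    unfolding S_def using K_pos q(2) by (intro C1_intros u'(2) q(1)) auto
  define h where "h t = deriv S t - 2 * q t * C t" for t
  have "continuous_on I C"
    using C' by (meson DERIV_continuous continuous_at_imp_continuous_on)
  then have h_cont: "continuous_on I h"
    unfolding h_def
    by (intro continuous_intros C1_differentiable_on_imp_deriv(2)[OF SC1]
        C1_differentiable_on_continuous[OF q(1)])
  \<comment> \<open>Differentiation of \<open>C\<^sup>2 + S\<^sup>2 = 1\<close> gives this
    product.\<close>
  have Sh: "S t * h t = 0" if "t \<in> I" for t
  proof -
    have "((\<lambda>t. (C t)\<^sup>2 + (S t)\<^sup>2) has_real_derivative
        2 * C t * (- 2 * q t * S t) + 2 * S t * deriv S t) (at t)"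
      by (auto intro!: derivative_eq_intros C' C1_differentiable_on_imp_deriv(1)[OF SC1] that)
    moreover have "((\<lambda>t. (C t)\<^sup>2 + (S t)\<^sup>2) has_real_derivative 0) (at t)"
      by (rule has_field_derivative_transform_within_open[OF DERIV_const[of 1] I(1) that])
         (simp add: CS)
    ultimately show ?thesis
      using DERIV_unique by (fastforce simp: h_def algebra_simps)
  qed
  have "(\<forall>t\<in>I. S t = 0) \<or> (\<forall>t\<in>I. h t = 0)"
  proof (rule factor_zero_if_mult_zero_C0[OF I(1) con Sh _ _ h_cont])
    show "(S has_real_derivative deriv S t) (at t)" if "t \<in> I" for t
      using SC1 C1_differentiable_on_imp_deriv(1) that by blast
    show "continuous_on I (deriv S)"
      using SC1 C1_differentiable_on_imp_deriv(2) by blast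
    \<comment> \<open>Where \<open>S\<close> vanishes, \<open>C\<close> is 1 or -1, so that
      \<open>h\<close> and the derivative of \<open>S\<close> cannot both be zero.\<close>
    show "h t \<noteq> 0" if "t \<in> I" "S t = 0" "deriv S t = 0" for t
      using CS[OF that(1)] q(2)[OF that(1)] that(2,3) by (auto simp: h_def)
  qed
  moreover have "\<not> (\<forall>t\<in>I. S t = 0)"
  proof
    assume "\<forall>t\<in>I. S t = 0"
    then have "(u has_vector_derivative 0) (at t)" if "t \<in> I" for t
      using u'(1)[OF that] u'_S[OF that] that
      by (simp add: has_real_derivative_iff_has_vector_derivative)
    then have "u constant_on I"
      using eq_if_vector_derivative_zero[OF I(2)] t0 unfolding constant_on_def by metis
    then show False using nonconst by blast
  qed
  ultimately have S': "(S has_real_derivative 2 * q t * C t) (at t)" if "t \<in> I" for t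
    using C1_differentiable_on_imp_deriv(1)[OF SC1 that] that by (auto simp: h_def)
  obtain \<alpha> where \<alpha>: "C t0 = cos \<alpha>" "S t0 = sin \<alpha>"
    using sincos_total_2pi[OF CS[OF t0]] by metis
  obtain \<phi> where \<phi>0: "\<phi> t0 = \<alpha> / 2" and \<phi>': "\<And>t. t \<in> I \<Longrightarrow> (\<phi> has_real_derivative q t) (at t)"
    using continuous_antiderivative_on_interval[OF I C1_differentiable_on_continuous[OF q(1)] t0] by metis
  have "cos (2 * \<phi> t) = C t \<and> sin (2 * \<phi> t) = S t" if t: "t \<in> I" for t
  proof -
    \<comment> \<open>Inner product of the unit vectors \<open>(C, S)\<close> and
      \<open>(cos 2\<phi>, sin 2\<phi>)\<close>. Both turn at the rate \<open>2 * q\<close>, so it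
      keeps its initial value 1, and the squared distance \<open>2 - 2 * X\<close> is zero.\<close>
    define X where "X t = C t * cos (2 * \<phi> t) + S t * sin (2 * \<phi> t)" for t
    have "(X has_vector_derivative 0) (at t)" if "t \<in> I" for t
      unfolding X_def has_real_derivative_iff_has_vector_derivative[symmetric]
      by (auto intro!: derivative_eq_intros C' S' \<phi>' that)
    then have "X t = X t0"
      using eq_if_vector_derivative_zero[OF I(2)] t t0 by blast
    also have "X t0 = 1"
      using sin_cos_squared_add[of \<alpha>] by (simp add: X_def \<phi>0 \<alpha> power2_eq_square)
    finally have "(C t - cos (2 * \<phi> t))\<^sup>2 + (S t - sin (2 * \<phi> t))\<^sup>2 = 0"
      using CS[OF t] sin_cos_squared_add[of "2 * \<phi> t"] unfolding X_def by algebra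
    then show ?thesis
      by (simp add: sum_power2_eq_zero_iff)
  qed
  then show ?thesis
    using that[of \<phi>] \<phi>' u_C u'_S by (simp add: U_cos)
qed

section \<open>Solutions of nonconstant radius run along the ellipse in GRFR\<close>

context linkage_grfr
begin

text \<open>The angle \<phi> from \<open>angle_exists\<close> makes the composition of
  \<open>curve\<close> with \<phi> a curve with the same logarithmic derivative as
  \<open>\<gamma>\<close>, so that the two are proportional. As their radii agree, the factor is a
  rotation.\<close>

lemma is_arc_of_grfr_ellipse:
  assumes sat: "satisfies_pedal_eq (linkage_pedal_eq r0 r1 a b) \<gamma> I"
    and nonconst: "\<not> (\<lambda>t. pedal_r \<gamma> t) constant_on I"
  shows "is_arc_of \<gamma> I (grfr_ellipse \<sigma> r1 \<bar>r0\<bar> A B)"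
proof -
  have reg: "regular_C2_curve \<gamma> I"
    and ped: "\<And>t. t \<in> I \<Longrightarrow> linkage_pedal_eq r0 r1 a b (pedal_r \<gamma> t) (pedal_p \<gamma> t)"
    using sat by (auto simp: satisfies_pedal_eq_def)
  have I: "open I" "is_interval I" and con: "connected I"
    using reg by (auto simp: regular_C2_curve_def is_interval_connected)
  have nz: "\<gamma> t \<noteq> 0" if "t \<in> I" for t
    using ped[OF that] by (auto simp: linkage_pedal_eq_def pedal_r_def)
  obtain m where m: "m C1_differentiable_on I" "\<And>t. t \<in> I \<Longrightarrow> m t \<noteq> 0"
    and \<gamma>': "\<And>t. t \<in> I \<Longrightarrow> (\<gamma> has_vector_derivative \<gamma> t * m t) (at t)"
    and vel: "\<And>t. t \<in> I \<Longrightarrow> velocity \<gamma> t = \<gamma> t * m t"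
    using regular_C2_curve_log_derivative[OF reg nz] by metis
  define u where "u t = 1 / (norm (\<gamma> t))\<^sup>2" for t
  define u' where "u' t = - 2 * u t * Re (m t)" for t
  have u_pos: "u t > 0" if "t \<in> I" for t
    using nz[OF that] by (simp add: u_def)
  have u': "(u has_real_derivative u' t) (at t)" if "t \<in> I" for t
  proof -
    have "((\<lambda>t. (norm (\<gamma> t))\<^sup>2) has_vector_derivative 2 * (\<gamma> t \<bullet> (\<gamma> t * m t))) (at t)"
      unfolding power2_norm_eq_inner
      using bounded_bilinear.has_vector_derivative[OF bounded_bilinear_inner \<gamma>'[OF that] \<gamma>'[OF that]]
      by (simp add: inner_commute)
    moreover have "\<gamma> t \<bullet> (\<gamma> t * m t) = (norm (\<gamma> t))\<^sup>2 * Re (m t)"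
      by (simp add: inner_complex_def cmod_power2) algebra
    ultimately have N: "((\<lambda>t. (norm (\<gamma> t))\<^sup>2) has_real_derivative 2 * ((norm (\<gamma> t))\<^sup>2 * Re (m t))) (at t)"
      by (simp add: has_real_derivative_iff_has_vector_derivative)
    show ?thesis
      using DERIV_inverse_fun[OF N] nz[OF that]
      by (simp add: u_def[abs_def] u'_def divide_inverse power2_eq_square mult_ac)
  qed
  have uC1: "u C1_differentiable_on I"
  proof -
    have "continuous_on I u'"
      unfolding u'_def using u' C1_differentiable_on_continuous[OF m(1)]
      by (intro continuous_intros) (meson DERIV_continuous continuous_at_imp_continuous_on)+
    then show ?thesis
      unfolding C1_differentiable_on_def using u'
      by (auto simp: has_real_derivative_iff_has_vector_derivative)
  qed
  have u'C1: "u' C1_differentiable_on I"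
    unfolding u'_def by (intro C1_intros uC1 m(1))
  have wC1: "(\<lambda>t. Im (m t)) C1_differentiable_on I"
    by (intro C1_intros m(1))
  have u'_nz: "u' t \<noteq> 0 \<or> Im (m t) \<noteq> 0" if "t \<in> I" for t
    using m(2)[OF that] u_pos[OF that] by (auto simp: u'_def complex_eq_iff)
  have eq: "(D (u t) * u' t)\<^sup>2 = (Im (m t))\<^sup>2 * Q (u t)" if "t \<in> I" for t
    using pedal_eq_iff[OF nz[OF that] vel[OF that] m(2)[OF that] u_def] ped[OF that]
    by (simp add: u'_def power_mult_distrib)
  obtain q where q: "q C1_differentiable_on I" "\<And>t. t \<in> I \<Longrightarrow> q t \<noteq> 0"
    "\<And>t. t \<in> I \<Longrightarrow> Im (m t) = D (u t) * q t" "\<And>t. t \<in> I \<Longrightarrow> (u' t)\<^sup>2 = Q (u t) * (q t)\<^sup>2"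
    using signed_rate[OF I(1) con u_pos u' u'C1 wC1 u'_nz eq] by metis
  have "\<not> u constant_on I"
  proof
    assume "u constant_on I"
    then have "pedal_r \<gamma> x = pedal_r \<gamma> y" if "x \<in> I" "y \<in> I" for x y
    proof -
      have "u x = u y"
        using \<open>u constant_on I\<close> that unfolding constant_on_def by metis
      then have "(norm (\<gamma> x))\<^sup>2 = (norm (\<gamma> y))\<^sup>2"
        by (simp add: u_def)
      then show ?thesis
        by (simp add: pedal_r_def)
    qed
    then show False
      using nonconst unfolding constant_on_def by blast
  qed
  then obtain \<phi> where \<phi>': "\<And>t. t \<in> I \<Longrightarrow> (\<phi> has_real_derivative q t) (at t)"
    and u_U: "\<And>t. t \<in> I \<Longrightarrow> u t = U (\<phi> t)"
    and u'_q: "\<And>t. t \<in> I \<Longrightarrow> u' t = K * sin (2 * \<phi> t) * q t"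
    using angle_exists[OF I u' u'C1 q(1,2,4)] by metis
  have m_L: "m t = L (\<phi> t) * of_real (q t)" if "t \<in> I" for t
  proof (rule complex_eqI)
    have "Re (m t) = - u' t / (2 * u t)"
      using u_pos[OF that] by (simp add: u'_def)
    then show "Re (m t) = Re (L (\<phi> t) * of_real (q t))"
      unfolding u'_q[OF that] by (simp add: L_def u_U[OF that])
    show "Im (m t) = Im (L (\<phi> t) * of_real (q t))"
      using q(3)[OF that] by (simp add: L_def u_U[OF that])
  qed
  have "((\<lambda>t. curve (\<phi> t)) has_vector_derivative curve (\<phi> t) * m t) (at t)" if "t \<in> I" for t
    using vector_diff_chain_at[OF \<phi>'[OF that, unfolded has_real_derivative_iff_has_vector_derivative]
        has_vector_derivative_curve]
    by (simp add: o_def m_L[OF that] scaleR_conv_of_real mult_ac)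
  then obtain c where c: "\<And>t. t \<in> I \<Longrightarrow> \<gamma> t = c * curve (\<phi> t)"
    using proportional_if_log_derivative_eq[OF I(2) \<gamma>' _ curve_nz] by metis
  obtain t0 where t0: "t0 \<in> I"
    using nonconst by (auto simp: constant_on_def)
  have "norm (curve (\<phi> t0)) = norm (\<gamma> t0)"
    using nz[OF t0] by (simp add: norm_curve real_sqrt_divide u_def flip: u_U[OF t0])
  then have "norm c = 1"
    using c[OF t0] nz[OF t0] by (simp add: norm_mult)
  then have c_cis: "c = cis (Arg c)"
    by (metis cis_Arg norm_zero sgn_eq zero_neq_one div_by_1 of_real_1)
  \<comment> \<open>The polar angle is turned back into the parameter of the ellipse of rotation.
    The derivative of \<tau> has the sign of \<open>q\<close>; a negative one means that the ellipse
    in GRFR is traversed backwards.\<close>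
  define \<tau> where "\<tau> t = rot_ellipse_angle B A (\<phi> t)" for t
  have \<tau>': "(\<tau> has_real_derivative rot_ellipse_rate B A (\<phi> t) * q t) (at t)" if "t \<in> I" for t
    unfolding \<tau>_def by (intro DERIV_chain2 has_real_derivative_rot_ellipse_angle BA \<phi>' that)
  have "\<phi> C1_differentiable_on I"
    unfolding C1_differentiable_on_def
    using \<phi>' C1_differentiable_on_continuous[OF q(1)]
    by (auto simp: has_real_derivative_iff_has_vector_derivative)
  then have "\<tau> C1_differentiable_on I"
    unfolding \<tau>_def
    by (rule C1_differentiable_on_chain)
       (auto intro!: has_real_derivative_rot_ellipse_angle BA
          C1_differentiable_on_continuous C1_differentiable_on_rot_ellipse_rate
          simp flip: has_real_derivative_iff_has_vector_derivative)
  moreover have "deriv \<tau> t \<noteq> 0" if "t \<in> I" for t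
    using DERIV_imp_deriv[OF \<tau>'[OF that]] rot_ellipse_rate_pos[OF BA, of "\<phi> t"] q(2)[OF that] by simp
  moreover have "\<gamma> t = cis (Arg c) * grfr_ellipse \<sigma> r1 \<bar>r0\<bar> A B (\<tau> t)" if "t \<in> I" for t
    using c[OF that] c_cis
    by (simp add: grfr_ellipse_eq \<tau>_def rot_ellipse_angle_inverse[OF BA])
  ultimately show ?thesis
    unfolding is_arc_of_def by blast
qed

end

text \<open>Circles about the origin with radius \<open>r1\<close> or \<open>\<bar>r0\<bar>\<close>
  solve the pedal equation as well, both sides being zero, and they are not arcs of the ellipse in
  GRFR; this is why the second part speaks of solutions with nonconstant radius. The semi-axis is
  \<open>\<bar>r0\<bar>\<close> because \<open>r0\<close> may be negative.\<close>

theorem corollary3: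
  fixes mx my mz l1 l2 M r0 r1 a b A B :: real
  assumes "mx > 0" "my > 0" "mz > 0" "l1 > 0" "l2 > 0"
    and "M = mx + my + mz"
    and "r1 = (l1 * (mz + my) + l2 * mz) / M"
    and "r0 = (l1 * (mz + my) - l2 * mz) / M"
    and "a = M * my * (r1 - r0)^2"
    and "b = 4 * mx * mz"
    and "r0 \<noteq> 0"
    and "A = sqrt \<bar>2 * r1 / r0 * ((a - b * r0 * r1) / (b * r1^2 + a))\<bar>"
    and "B = sqrt \<bar>2 * r0 / r1 * ((a - b * r0 * r1) / (b * r0^2 + a))\<bar>"
  shows "\<exists>\<sigma>\<in>{1, -1}.
    satisfies_pedal_eq (linkage_pedal_eq r0 r1 a b) (grfr_ellipse \<sigma> r1 \<bar>r0\<bar> A B) UNIV \<and>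
    (\<forall>\<gamma> I. satisfies_pedal_eq (linkage_pedal_eq r0 r1 a b) \<gamma> I \<and>
            \<not> (\<lambda>t. pedal_r \<gamma> t) constant_on I
        \<longrightarrow> is_arc_of \<gamma> I (grfr_ellipse \<sigma> r1 \<bar>r0\<bar> A B))"
proof -
  have M: "M > 0" using assms by simp
  \<comment> \<open>The positivity of these two numbers is the locale assumption
    \<open>\<bar>r0\<bar> < r1\<close>.\<close>
  have "r1 - r0 = 2 * (l2 * mz) / M" "r1 + r0 = 2 * (l1 * (mz + my)) / M"
    using M unfolding assms(7,8) by (simp_all add: field_simps)
  then have diff: "r1 - r0 > 0" and "r1 + r0 > 0"
    using M assms(1-5) by simp_all
  then interpret linkage_pedal r0 r1 a b
    using M assms(1-3,9-11) by unfold_locales auto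
  define k where "k = (a - b * r0 * r1) / (r0 * r1)"
  \<comment> \<open>The sign is chosen so that \<open>\<sigma> * \<bar>k\<bar> = k\<close>, because
    \<open>D u - 1 = k / (b + a * u)\<close> has the sign of \<open>k\<close> for positive
    \<open>u\<close>.\<close>
  define \<sigma> :: real where "\<sigma> = (if k \<ge> 0 then 1 else -1)"
  note grfr = grfr_rate[OF r0_nz r1_pos a_pos b_pos assms(12,13)]
  interpret linkage_grfr r0 r1 a b \<sigma> A B
  proof
    show "A > 0 \<and> B > 0 \<or> A = 0 \<and> B = 0"
      by (rule grfr(1))
    fix \<phi>
    have pos: "b + a * U \<phi> > 0"
      using a_pos b_pos U_pos by (simp add: add_pos_pos)
    have "\<sigma> * (A * B / 2) * rot_ellipse_rate B A \<phi> = \<sigma> * (\<bar>k\<bar> / (b + a * U \<phi>))"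
      by (simp only: mult.assoc[of \<sigma>] grfr(2) U_def k_def)
    also have "\<dots> = k / (b + a * U \<phi>)"
      by (simp add: \<sigma>_def)
    also have "1 + \<dots> = D (U \<phi>)"
      using pos r0_nz r1_pos unfolding k_def D_def by (simp add: divide_simps) (simp add: algebra_simps)
    finally show "1 + \<sigma> * (A * B / 2) * rot_ellipse_rate B A \<phi> = D (U \<phi>)" by simp
  qed
  have "\<sigma> \<in> {1, -1}" by (simp add: \<sigma>_def)
  then show ?thesis
    using satisfies_grfr_ellipse is_arc_of_grfr_ellipse by blast
qed

end
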